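(* Let $\sigma$ be a connection on $B(\mathcal{H})^+$ which is not a scalar multiple of the left-trivial mean $(A,B)\mapsto A$, and let $f$ be its representing function. Given $A>0$ and $B\ge 0$ in $B(\mathcal{H})$, the operator equation $A\,\sigma\,X=B$ has a positive solution $X\in B(\mathcal{H})^+$ if and only if $\operatorname{Sp}(A^{-1/2}BA^{-1/2})\subseteq \operatorname{Range}(f)$. In fact, such a solution is unique and given by $$X=A^{1/2}f^{-1}(A^{-1/2}BA^{-1/2})A^{1/2}.$$
   Context: $\mathcal{H}$ is a Hilbert space, $B(\mathcal{H})$ the bounded linear operators on it, $B(\mathcal{H})^+$ the positive (semidefinite) operators; $A\le B$ means $B-A\in B(\mathcal{H})^+$; $A>0$ means $A$ is strictly positive (positive and invertible); $\operatorname{Sp}(X)$ is the spectrum of $X$. A connection is a binary operation $\sigma$ on $B(\mathcal{H})^+$ such that for all positive $A,B,C,D$: (M1) $A\le C$, $B\le D$ imply $A\,\sigma\,B\le C\,\sigma\,D$; (M2) $C(A\,\sigma\,B)C\le (CAC)\,\sigma\,(CBC)$; (M3) if $A_n\downarrow A$ and $B_n\downarrow B$ then $A_n\,\sigma\,B_n\downarrow A\,\sigma\,B$, where $A_n\downarrow A$ means $(A_n)$ is a decreasing sequence converging strongly to $A$. A function $f:[0,\infty)\to[0,\infty)$ is operator monotone if (with the continuous functional calculus, $f$ continuous) $A\le B$ implies $f(A)\le f(B)$ for all positive operators $A,B$ on every Hilbert space. Representing function (Kubo–Ando theorem, taken as known): for a connection $\sigma$ there is a unique operator monotone $f:[0,\infty)\to[0,\infty)$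 with $f(x)I=I\,\sigma\,(xI)$ for all $x\ge 0$; $\sigma\mapsto f$ is a bijection, and $f(A)=I\,\sigma\,A$ for all $A\ge0$. $f^{-1}$ denotes the inverse function $\operatorname{Range}(f)\to[0,\infty)$ ($f$ is injective under the stated hypothesis), applied by the continuous functional calculus. Scalars in "scalar multiple" are nonnegative reals. *)

theory Defs
  imports "HOL-Analysis.Analysis" "HOL-Computational_Algebra.Polynomial"
    "HOL-Library.Nonpos_Ints"
begin

text \<open>The complex inner product is linear in its first argument. Norm, topology and
  completeness are those of the underlying real Hilbert space, whose inner product is the
  real part of the complex one; positive definiteness is inherited from it.\<close>

class complex_hilbert_space = real_inner + complete_space +
  fixes scaleC :: "complex \<Rightarrow> 'a \<Rightarrow> 'a"  (infixr \<open>*\<^sub>C\<close> 75)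
    and cinner :: "'a \<Rightarrow> 'a \<Rightarrow> complex"
  assumes scaleC_add_right: "c *\<^sub>C (x + y) = c *\<^sub>C x + c *\<^sub>C y"
    and scaleC_add_left: "(c + d) *\<^sub>C x = c *\<^sub>C x + d *\<^sub>C x"
    and scaleC_scaleC: "c *\<^sub>C d *\<^sub>C x = (c * d) *\<^sub>C x"
    and scaleC_of_real: "complex_of_real r *\<^sub>C x = r *\<^sub>R x"
    and cinner_commute: "cinner x y = cnj (cinner y x)"
    and cinner_add_left: "cinner (x + y) z = cinner x z + cinner y z"
    and cinner_scaleC_left: "cinner (c *\<^sub>C x) y = c * cinner x y"
    and Re_cinner: "Re (cinner x y) = inner x y"

subclass (in complex_hilbert_space) banach ..

text \<open>The type \<^typ>\<open>'h \<Rightarrow>\<^sub>L 'h\<close> consists of the bounded real-linear maps; \<open>B(H)\<close> is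
  the subset of the complex-linear ones.\<close>

type_synonym 'h op = "'h \<Rightarrow>\<^sub>L 'h"

definition bounded_ops :: "'h::complex_hilbert_space op set"
  where "bounded_ops = {T. \<forall>c x. blinfun_apply T (c *\<^sub>C x) = c *\<^sub>C blinfun_apply T x}"

definition pos_ops :: "'h::complex_hilbert_space op set"
  where "pos_ops = {T \<in> bounded_ops. \<forall>x. cinner (blinfun_apply T x) x \<in> \<real>\<^sub>\<ge>\<^sub>0}"

definition op_le :: "'h::complex_hilbert_space op \<Rightarrow> 'h op \<Rightarrow> bool"  (infix \<open>\<preceq>\<close> 50)
  where "A \<preceq> B \<longleftrightarrow> B - A \<in> pos_ops"

definition invertible_op :: "'h::complex_hilbert_space op \<Rightarrow> bool"
  where "invertible_op T \<longleftrightarrow>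
    (\<exists>S\<in>bounded_ops. S o\<^sub>L T = id_blinfun \<and> T o\<^sub>L S = id_blinfun)"

definition strictly_pos_ops :: "'h::complex_hilbert_space op set"
  where "strictly_pos_ops = {T \<in> pos_ops. invertible_op T}"

lemma norm_scaleC:
  fixes x :: "'h::complex_hilbert_space"
  shows "norm (c *\<^sub>C x) = cmod c * norm x"
proof -
  have self: "cinner y y = complex_of_real ((norm y)\<^sup>2)" for y :: 'h
  proof -
    have "cinner y y = cnj (cinner y y)" by (rule cinner_commute)
    then have "Im (cinner y y) = 0" by (simp add: complex_eq_iff)
    then show ?thesis by (simp add: complex_eq_iff Re_cinner power2_norm_eq_inner)
  qed
  have "cinner (c *\<^sub>C x) (c *\<^sub>C x) = c * cnj (cinner (c *\<^sub>C x) x)"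
    by (metis cinner_scaleC_left cinner_commute)
  also have "\<dots> = complex_of_real ((cmod c * norm x)\<^sup>2)"
    by (simp add: cinner_scaleC_left self power_mult_distrib complex_norm_square
        del: of_real_power)
  finally have "(norm (c *\<^sub>C x))\<^sup>2 = (cmod c * norm x)\<^sup>2"
    unfolding self of_real_eq_iff .
  then show ?thesis
    by (rule power2_eq_imp_eq) simp_all
qed

lift_definition scalar_op :: "complex \<Rightarrow> 'h::complex_hilbert_space op"
  is "\<lambda>c x. c *\<^sub>C x"
proof (rule bounded_linear_intro)
  fix c :: complex and x y :: 'h and r :: real
  show "c *\<^sub>C (x + y) = c *\<^sub>C x + c *\<^sub>C y" by (rule scaleC_add_right)
  show "c *\<^sub>C r *\<^sub>R x = r *\<^sub>R c *\<^sub>C x"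
    by (simp add: scaleC_of_real [symmetric] scaleC_scaleC mult.commute)
  show "norm (c *\<^sub>C x) \<le> norm x * cmod c" by (simp add: norm_scaleC mult.commute)
qed

definition spectrum :: "'h::complex_hilbert_space op \<Rightarrow> complex set"
  where "spectrum T = {z. \<not> invertible_op (T - scalar_op z)}"

definition poly_op :: "real poly \<Rightarrow> 'h::complex_hilbert_space op \<Rightarrow> 'h op"
  where "poly_op p A = (\<Sum>i\<le>degree p. coeff p i *\<^sub>R ((o\<^sub>L) A ^^ i) id_blinfun)"

text \<open>For self-adjoint \<open>A\<close> (whose spectrum is real) and a real function \<open>f\<close> continuous on the
  spectrum, \<open>f(A)\<close> is the common norm limit of \<open>p\<^sub>n(A)\<close> over all sequences of real polynomials
  converging to \<open>f\<close> uniformly on the spectrum.\<close>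

definition cfc :: "(real \<Rightarrow> real) \<Rightarrow> 'h::complex_hilbert_space op \<Rightarrow> 'h op"
  where "cfc f A = (THE T. \<forall>p :: nat \<Rightarrow> real poly.
    uniform_limit {r. complex_of_real r \<in> spectrum A} (\<lambda>n. poly (p n)) f sequentially
      \<longrightarrow> (\<lambda>n. poly_op (p n) A) \<longlonglongrightarrow> T)"

definition op_powr :: "'h::complex_hilbert_space op \<Rightarrow> real \<Rightarrow> 'h op"
  where "op_powr A s = cfc (\<lambda>x. x powr s) A"

typedef ell2 = "{a :: nat \<Rightarrow> complex. summable (\<lambda>n. (cmod (a n))\<^sup>2)}"
  morphisms coord Abs_ell2
  by (rule exI [of _ "\<lambda>_. 0"]) simp

setup_lifting type_definition_ell2

lemma summable_sq_add:
  assumes "summable (\<lambda>n. (cmod (a n))\<^sup>2)" "summable (\<lambda>n. (cmod (b n))\<^sup>2)"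
  shows "summable (\<lambda>n. (cmod (a n + b n))\<^sup>2)"
proof (rule summable_comparison_test')
  show "summable (\<lambda>n. 2 * (cmod (a n))\<^sup>2 + 2 * (cmod (b n))\<^sup>2)"
    by (intro summable_add summable_mult assms)
  fix n :: nat
  have "(cmod (a n + b n))\<^sup>2 \<le> (cmod (a n) + cmod (b n))\<^sup>2"
    by (intro power_mono norm_triangle_ineq) simp
  also have "\<dots> \<le> 2 * (cmod (a n))\<^sup>2 + 2 * (cmod (b n))\<^sup>2"
    using sum_squares_bound [of "cmod (a n)" "cmod (b n)"] by (simp add: power2_sum)
  finally show "norm ((cmod (a n + b n))\<^sup>2) \<le> 2 * (cmod (a n))\<^sup>2 + 2 * (cmod (b n))\<^sup>2"
    by simp
qed

lemma summable_sq_mult: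
  assumes "summable (\<lambda>n. (cmod (a n))\<^sup>2)"
  shows "summable (\<lambda>n. (cmod (c * a n))\<^sup>2)"
  using summable_mult [OF assms, of "(cmod c)\<^sup>2"] by (simp add: norm_mult power_mult_distrib)

lemma summable_cinner:
  assumes "summable (\<lambda>n. (cmod (a n))\<^sup>2)" "summable (\<lambda>n. (cmod (b n))\<^sup>2)"
  shows "summable (\<lambda>n. a n * cnj (b n))"
proof (rule summable_comparison_test')
  show "summable (\<lambda>n. (cmod (a n))\<^sup>2 + (cmod (b n))\<^sup>2)"
    by (intro summable_add assms)
  fix n :: nat
  have "0 \<le> cmod (a n) * cmod (b n)" by simp
  with sum_squares_bound [of "cmod (a n)" "cmod (b n)"]
  have "cmod (a n) * cmod (b n) \<le> (cmod (a n))\<^sup>2 + (cmod (b n))\<^sup>2" by linarith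
  then show "norm (a n * cnj (b n)) \<le> (cmod (a n))\<^sup>2 + (cmod (b n))\<^sup>2"
    by (simp add: norm_mult)
qed

lemma coord_summable: "summable (\<lambda>n. (cmod (coord x n))\<^sup>2)"
  using coord [of x] by simp

lemma cinner_summable: "summable (\<lambda>n. coord x n * cnj (coord y n))"
  by (intro summable_cinner coord_summable)

definition cinner_sum :: "ell2 \<Rightarrow> ell2 \<Rightarrow> complex"
  where "cinner_sum x y = (\<Sum>n. coord x n * cnj (coord y n))"

instantiation ell2 :: real_inner
begin

lift_definition zero_ell2 :: ell2 is "\<lambda>_. 0" by simp
lift_definition plus_ell2 :: "ell2 \<Rightarrow> ell2 \<Rightarrow> ell2" is "\<lambda>a b n. a n + b n"
  by (rule summable_sq_add)
lift_definition uminus_ell2 :: "ell2 \<Rightarrow> ell2" is "\<lambda>a n. - a n" by simp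
lift_definition minus_ell2 :: "ell2 \<Rightarrow> ell2 \<Rightarrow> ell2" is "\<lambda>a b n. a n - b n"
  using summable_sq_add [of _ "\<lambda>n. - _ n"] by simp
lift_definition scaleR_ell2 :: "real \<Rightarrow> ell2 \<Rightarrow> ell2" is "\<lambda>r a n. complex_of_real r * a n"
  by (rule summable_sq_mult)
definition inner_ell2 :: "ell2 \<Rightarrow> ell2 \<Rightarrow> real"
  where "inner_ell2 x y = Re (cinner_sum x y)"
definition norm_ell2 :: "ell2 \<Rightarrow> real"
  where "norm_ell2 x = sqrt (inner x x)"
definition sgn_ell2 :: "ell2 \<Rightarrow> ell2"
  where "sgn_ell2 x = inverse (norm x) *\<^sub>R x"
definition dist_ell2 :: "ell2 \<Rightarrow> ell2 \<Rightarrow> real"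
  where "dist_ell2 x y = norm (x - y)"
definition uniformity_ell2 :: "(ell2 \<times> ell2) filter"
  where "uniformity_ell2 = (INF e\<in>{0<..}. principal {(x, y). dist x y < e})"
definition open_ell2 :: "ell2 set \<Rightarrow> bool"
  where "open_ell2 U \<longleftrightarrow> (\<forall>x\<in>U. \<forall>\<^sub>F (x', y) in uniformity. x' = x \<longrightarrow> y \<in> U)"

lemma cinner_sum_commute: "cinner_sum x y = cnj (cinner_sum y x)"
  unfolding cinner_sum_def
  by (subst bounded_linear.suminf [OF bounded_linear_cnj cinner_summable])
    (simp add: mult.commute)

lemma cinner_sum_add_left: "cinner_sum (x + y) z = cinner_sum x z + cinner_sum y z"
  unfolding cinner_sum_def
  by (simp add: suminf_add [OF cinner_summable cinner_summable] plus_ell2.rep_eq algebra_simps)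

lemma inner_self_ell2: "inner (x::ell2) x = (\<Sum>n. (cmod (coord x n))\<^sup>2)"
proof -
  have "cinner_sum x x = (\<Sum>n. complex_of_real ((cmod (coord x n))\<^sup>2))"
    unfolding cinner_sum_def by (simp only: complex_norm_square)
  also have "\<dots> = complex_of_real (\<Sum>n. (cmod (coord x n))\<^sup>2)"
    by (rule suminf_of_real [OF coord_summable, symmetric])
  finally show ?thesis by (simp add: inner_ell2_def)
qed

lemma norm_sq_ell2: "(norm (x::ell2))\<^sup>2 = (\<Sum>n. (cmod (coord x n))\<^sup>2)"
  unfolding norm_ell2_def inner_self_ell2
  by (simp add: suminf_nonneg coord_summable)

lemma norm_nonneg_ell2: "norm (x::ell2) \<ge> 0"
  unfolding norm_ell2_def inner_self_ell2
  by (simp add: suminf_nonneg coord_summable)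

lemma partial_sum_ell2: "(\<Sum>n<K. (cmod (coord x n))\<^sup>2) \<le> (norm (x::ell2))\<^sup>2"
  unfolding norm_sq_ell2 by (intro sum_le_suminf coord_summable) auto

lemma coord_le_norm_ell2: "cmod (coord x k) \<le> norm (x::ell2)"
proof -
  have "(cmod (coord x k))\<^sup>2 \<le> (\<Sum>n<Suc k. (cmod (coord x n))\<^sup>2)"
    by (rule member_le_sum) auto
  also have "\<dots> \<le> (norm x)\<^sup>2" by (rule partial_sum_ell2)
  finally show ?thesis by (rule power2_le_imp_le) (rule norm_nonneg_ell2)
qed

instance
proof
  fix x y z :: ell2 and r s :: real and U :: "ell2 set"
  show "x + y + z = x + (y + z)" by transfer (simp add: add.assoc)
  show "x + y = y + x" by transfer (simp add: add.commute)
  show "0 + x = x" by transfer simp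
  show "- x + x = 0" by transfer simp
  show "x - y = x + - y" by transfer simp
  show "r *\<^sub>R (x + y) = r *\<^sub>R x + r *\<^sub>R y" by transfer (simp add: algebra_simps)
  show "(r + s) *\<^sub>R x = r *\<^sub>R x + s *\<^sub>R x" by transfer (simp add: algebra_simps)
  show "r *\<^sub>R s *\<^sub>R x = (r * s) *\<^sub>R x" by transfer (simp add: algebra_simps)
  show "1 *\<^sub>R x = x" by transfer simp
  show "inner x y = inner y x"
    by (subst inner_ell2_def, subst cinner_sum_commute) (simp add: inner_ell2_def)
  show "inner (x + y) z = inner x z + inner y z"
    by (simp add: inner_ell2_def cinner_sum_add_left)
  have "cinner_sum (r *\<^sub>R x) y = complex_of_real r * cinner_sum x y"
    unfolding cinner_sum_def
    by (simp add: suminf_mult [OF cinner_summable] scaleR_ell2.rep_eq mult.assoc)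
  then show "inner (r *\<^sub>R x) y = r * inner x y" by (simp add: inner_ell2_def)
  show "0 \<le> inner x x" unfolding inner_self_ell2 by (simp add: suminf_nonneg coord_summable)
  show "inner x x = 0 \<longleftrightarrow> x = 0"
    unfolding inner_self_ell2 suminf_eq_zero_iff [OF coord_summable zero_le_power2]
    by transfer auto
  show "norm x = sqrt (inner x x)" by (rule norm_ell2_def)
  show "sgn x = inverse (norm x) *\<^sub>R x" by (rule sgn_ell2_def)
  show "dist x y = norm (x - y)" by (rule dist_ell2_def)
  show "uniformity = (INF e\<in>{0<..}. principal {(x, y :: ell2). dist x y < e})"
    by (rule uniformity_ell2_def)
  show "open U \<longleftrightarrow> (\<forall>x\<in>U. \<forall>\<^sub>F (x', y) in uniformity. x' = x \<longrightarrow> y \<in> U)"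
    by (rule open_ell2_def)
qed

end

instantiation ell2 :: complex_hilbert_space
begin

lift_definition scaleC_ell2 :: "complex \<Rightarrow> ell2 \<Rightarrow> ell2" is "\<lambda>c a n. c * a n"
  by (rule summable_sq_mult)
definition cinner_ell2 :: "ell2 \<Rightarrow> ell2 \<Rightarrow> complex"
  where "cinner_ell2 = cinner_sum"

instance
proof
  fix x y z :: ell2 and r :: real and c d :: complex
  show "c *\<^sub>C (x + y) = c *\<^sub>C x + c *\<^sub>C y" by transfer (simp add: algebra_simps)
  show "(c + d) *\<^sub>C x = c *\<^sub>C x + d *\<^sub>C x" by transfer (simp add: algebra_simps)
  show "c *\<^sub>C d *\<^sub>C x = (c * d) *\<^sub>C x" by transfer (simp add: algebra_simps)
  show "complex_of_real r *\<^sub>C x = r *\<^sub>R x" by transfer simp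
  show "cinner x y = cnj (cinner y x)" unfolding cinner_ell2_def by (rule cinner_sum_commute)
  show "cinner (x + y) z = cinner x z + cinner y z"
    unfolding cinner_ell2_def by (rule cinner_sum_add_left)
  show "cinner (c *\<^sub>C x) y = c * cinner x y"
    unfolding cinner_ell2_def cinner_sum_def
    by (simp add: suminf_mult [OF cinner_summable] scaleC_ell2.rep_eq mult.assoc)
  show "Re (cinner x y) = inner x y" by (simp add: inner_ell2_def cinner_ell2_def)
next
  fix X :: "nat \<Rightarrow> ell2"
  assume cauchy: "Cauchy X"
  have close: "\<exists>N. \<forall>m\<ge>N. \<forall>k\<ge>N. norm (X m - X k) < e" if "e > 0" for e
    using cauchy that unfolding Cauchy_def dist_ell2_def by blast
  have "Cauchy (\<lambda>m. coord (X m) n)" for n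
    unfolding Cauchy_def
  proof (intro allI impI)
    fix e :: real assume "e > 0"
    then obtain N where N: "\<forall>m\<ge>N. \<forall>k\<ge>N. norm (X m - X k) < e" using close by blast
    have "dist (coord (X m) n) (coord (X k) n) \<le> norm (X m - X k)" for m k
      using coord_le_norm_ell2 [of "X m - X k" n]
      by (simp add: minus_ell2.rep_eq dist_norm)
    with N show "\<exists>M. \<forall>m\<ge>M. \<forall>k\<ge>M. dist (coord (X m) n) (coord (X k) n) < e"
      by (meson le_less_trans)
  qed
  then have "\<exists>l. (\<lambda>m. coord (X m) n) \<longlonglongrightarrow> l" for n
    by (simp add: Cauchy_convergent_iff convergent_def)
  then obtain l where l: "\<And>n. (\<lambda>m. coord (X m) n) \<longlonglongrightarrow> l n" by metis
  have tail: "(\<Sum>n<K. (cmod (coord (X m) n - l n))\<^sup>2) \<le> e\<^sup>2"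
    if N: "\<forall>m\<ge>N. \<forall>k\<ge>N. norm (X m - X k) < e" and "m \<ge> N" for m N K e
  proof (rule LIMSEQ_le_const2)
    show "(\<lambda>k. \<Sum>n<K. (cmod (coord (X m) n - coord (X k) n))\<^sup>2)
        \<longlonglongrightarrow> (\<Sum>n<K. (cmod (coord (X m) n - l n))\<^sup>2)"
      by (intro tendsto_intros l)
    have "(\<Sum>n<K. (cmod (coord (X m) n - coord (X k) n))\<^sup>2) \<le> e\<^sup>2" if "k \<ge> N" for k
    proof -
      have "(\<Sum>n<K. (cmod (coord (X m) n - coord (X k) n))\<^sup>2) \<le> (norm (X m - X k))\<^sup>2"
        using partial_sum_ell2 [of "X m - X k" K] by (simp add: minus_ell2.rep_eq)
      also have "\<dots> \<le> e\<^sup>2"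
        using N \<open>m \<ge> N\<close> that by (intro power_mono norm_nonneg_ell2) (auto simp: less_imp_le)
      finally show ?thesis .
    qed
    then show "\<exists>M. \<forall>k\<ge>M. (\<Sum>n<K. (cmod (coord (X m) n - coord (X k) n))\<^sup>2) \<le> e\<^sup>2"
      by blast
  qed
  have diff: "summable (\<lambda>n. (cmod (coord (X m) n - l n))\<^sup>2)"
    if N: "\<forall>m\<ge>N. \<forall>k\<ge>N. norm (X m - X k) < e" and "m \<ge> N" for m N e
    by (rule summableI_nonneg_bounded [OF _ tail [OF that]]) simp
  obtain N1 where N1: "\<forall>m\<ge>N1. \<forall>k\<ge>N1. norm (X m - X k) < 1" using close [of 1] by auto
  have "summable (\<lambda>n. (cmod (coord (X N1) n + (- 1) * (coord (X N1) n - l n)))\<^sup>2)"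
    by (intro summable_sq_add summable_sq_mult coord_summable diff [OF N1]) simp
  then have sl: "summable (\<lambda>n. (cmod (l n))\<^sup>2)" by simp
  define L where "L = Abs_ell2 l"
  have L: "coord L = l" unfolding L_def using sl by (simp add: Abs_ell2_inverse)
  have "(\<lambda>m. X m) \<longlonglongrightarrow> L"
    unfolding LIMSEQ_def
  proof (intro allI impI)
    fix e :: real assume "e > 0"
    then obtain N where N: "\<forall>m\<ge>N. \<forall>k\<ge>N. norm (X m - X k) < e / 2"
      using close [of "e / 2"] by auto
    have "dist (X m) L < e" if "m \<ge> N" for m
    proof -
      have "(norm (X m - L))\<^sup>2 = (\<Sum>n. (cmod (coord (X m) n - l n))\<^sup>2)"
        unfolding norm_sq_ell2 by (simp add: minus_ell2.rep_eq L)
      also have "\<dots> \<le> (e / 2)\<^sup>2"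
        by (intro suminf_le_const diff [OF N that] tail [OF N that])
      finally have "norm (X m - L) \<le> e / 2"
        by (rule power2_le_imp_le) (use \<open>e > 0\<close> in simp)
      then show ?thesis using \<open>e > 0\<close> by (simp add: dist_ell2_def)
    qed
    then show "\<exists>N. \<forall>m\<ge>N. dist (X m) L < e" by blast
  qed
  then show "convergent X" unfolding convergent_def by blast
qed

end

text \<open>HOL cannot quantify over all Hilbert spaces, as that is a quantification over types.
  Monotonicity is required on the single infinite-dimensional space \<^typ>\<open>ell2\<close>. It implies
  monotonicity on every Hilbert space: every finite-dimensional or separable space embeds as
  a direct summand, and a pair of operators on any space is the direct sum of its restrictions
  to separable reducing subspaces. The type of the space a connection acts on
  would not do instead, since that space may be one-dimensional.\<close>

definition operator_monotone :: "(real \<Rightarrow> real) \<Rightarrow> bool"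
  where "operator_monotone f \<longleftrightarrow>
    f \<in> {0..} \<rightarrow> {0..} \<and> continuous_on {0..} f \<and>
    (\<forall>A\<in>pos_ops. \<forall>B\<in>(pos_ops :: ell2 op set). A \<preceq> B \<longrightarrow> cfc f A \<preceq> cfc f B)"

definition decreases_to ::
    "(nat \<Rightarrow> 'h::complex_hilbert_space op) \<Rightarrow> 'h op \<Rightarrow> bool"
  where "decreases_to As A \<longleftrightarrow>
    (\<forall>n. As (Suc n) \<preceq> As n) \<and>
    (\<forall>x. (\<lambda>n. blinfun_apply (As n) x) \<longlonglongrightarrow> blinfun_apply A x)"

definition connection :: "('h::complex_hilbert_space op \<Rightarrow> 'h op \<Rightarrow> 'h op) \<Rightarrow> bool"
  where "connection \<sigma> \<longleftrightarrow>
    (\<forall>A\<in>pos_ops. \<forall>B\<in>pos_ops. \<sigma> A B \<in> pos_ops) \<and>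
    (\<forall>A\<in>pos_ops. \<forall>B\<in>pos_ops. \<forall>C\<in>pos_ops. \<forall>D\<in>pos_ops.
      A \<preceq> C \<longrightarrow> B \<preceq> D \<longrightarrow> \<sigma> A B \<preceq> \<sigma> C D) \<and>
    (\<forall>A\<in>pos_ops. \<forall>B\<in>pos_ops. \<forall>C\<in>pos_ops.
      C o\<^sub>L \<sigma> A B o\<^sub>L C \<preceq> \<sigma> (C o\<^sub>L A o\<^sub>L C) (C o\<^sub>L B o\<^sub>L C)) \<and>
    (\<forall>As Bs. \<forall>A\<in>pos_ops. \<forall>B\<in>pos_ops.
      range As \<subseteq> pos_ops \<longrightarrow> range Bs \<subseteq> pos_ops \<longrightarrow>
      decreases_to As A \<longrightarrow> decreases_to Bs B \<longrightarrow>
      decreases_to (\<lambda>n. \<sigma> (As n) (Bs n)) (\<sigma> A B))"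

text \<open>Functions on \<open>[0,\<infinity>)\<close> are total functions on the reals whose values at negative
  arguments are irrelevant, and a connection is a total binary function on operators whose
  values outside the positive cone are irrelevant.\<close>

definition scalar_multiple_of_left_trivial ::
    "('h::complex_hilbert_space op \<Rightarrow> 'h op \<Rightarrow> 'h op) \<Rightarrow> bool"
  where "scalar_multiple_of_left_trivial \<sigma> \<longleftrightarrow>
    (\<exists>c\<ge>0. \<forall>A\<in>pos_ops. \<forall>B\<in>pos_ops. \<sigma> A B = c *\<^sub>R A)"

definition representing_function ::
    "('h::complex_hilbert_space op \<Rightarrow> 'h op \<Rightarrow> 'h op) \<Rightarrow> (real \<Rightarrow> real) \<Rightarrow> bool"
  where "representing_function \<sigma> f \<longleftrightarrow>
    operator_monotone f \<and>
    (\<forall>x\<ge>0. f x *\<^sub>R id_blinfun = \<sigma> id_blinfun (x *\<^sub>R id_blinfun))"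

end

theory Submission
  imports Defs "HOL-Computational_Algebra.Fundamental_Theorem_Algebra"
begin

text \<open>For positive \<open>A\<close> put \<open>T = I \<sigma> A\<close>. The transformer inequality and monotonicity give
  \<open>g(A) T g(A) \<le> g(A)\<^sup>2 \<sigma> A g(A)\<^sup>2 \<le> T\<close> for \<open>0 \<le> g \<le> 1\<close>. Hence \<open>T\<close> is local,
  \<open>\<psi>(A) T k(A) = 0\<close> whenever \<open>\<psi> k = 0\<close>, and on spectral pieces of \<open>A\<close> near \<open>x\<close> its form is
  squeezed between values of \<open>f\<close> near \<open>x\<close>; a partition of unity then yields \<open>I \<sigma> A = f(A)\<close>.
  Congruence by \<open>A\<^sup>1\<^sup>/\<^sup>2\<close> reduces \<open>A \<sigma> X = B\<close> to
  \<open>f(A\<^sup>-\<^sup>1\<^sup>/\<^sup>2 X A\<^sup>-\<^sup>1\<^sup>/\<^sup>2) = A\<^sup>-\<^sup>1\<^sup>/\<^sup>2 B A\<^sup>-\<^sup>1\<^sup>/\<^sup>2\<close>, which is solved by inverting \<open>f\<close>: an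
  operator monotone function with \<open>f(l) = f(l')\<close> for some \<open>l < l'\<close> is constant, and a constant
  \<open>f\<close> belongs to a multiple of the left-trivial mean.\<close>

section \<open>Self-adjoint and positive operators\<close>

text \<open>\<open>representing_function\<close> fixes \<sigma> only at the pairs (I, x I), so I
  \<sigma> A = f(A) has to be earned. Sharp spectral cutoffs of A would split the problem into
  orthogonal blocks; continuous functions of A give overlapping pieces instead. The price is the
  off-diagonal terms between neighbours. They are paid for by Cauchy-Schwarz for the positive
  operator T - f(c) g(A)^2, whose form is small on a short spectral interval. The resulting error is
  a fixed multiple of the oscillation of f, independent of the number of pieces, so the mesh can be
  refined at will. The transformer inequality is one-sided, but for invertible positive C it also
  applies to the inverse and becomes an equality. This serves twice: in the upper bound on the
  pieces and in the congruence by A^(1/2). Injectivity of f is decided on \<open>ell2\<close>, never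
  on the space of \<sigma>, which may have dimension one. Two nearly parallel lines suffice there,
  since every operator involved has the form a I + s Q with a projection Q.\<close>

lemmas op_simps = blinfun.add_left blinfun.diff_left blinfun.minus_left blinfun.zero_left
  blinfun.scaleR_left blinfun.add_right blinfun.diff_right blinfun.minus_right blinfun.zero_right
  blinfun.scaleR_right blinfun_apply_blinfun_compose blinfun_apply_id_blinfun scalar_op.rep_eq

lemma scaleC_zero [simp]: "(0::complex) *\<^sub>C x = (0::'h::complex_hilbert_space)"
  using scaleC_of_real [of 0 x] by simp

lemma scaleC_scaleR_right: "c *\<^sub>C (r *\<^sub>R (x::'h::complex_hilbert_space)) = r *\<^sub>R (c *\<^sub>C x)"
  by (metis mult.commute scaleC_of_real scaleC_scaleC)

lemma scaleC_minus_right: "c *\<^sub>C (- (x::'h::complex_hilbert_space)) = - (c *\<^sub>C x)"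
  using scaleC_scaleR_right [of c "-1" x] by simp

lemma scaleC_diff_right: "c *\<^sub>C (x - (y::'h::complex_hilbert_space)) = c *\<^sub>C x - c *\<^sub>C y"
  using scaleC_add_right [of c x "- y"] by (simp add: scaleC_minus_right)

lemma scaleC_zero_right [simp]: "c *\<^sub>C (0::'h::complex_hilbert_space) = 0"
  using scaleC_scaleR_right [of c 0 "0 :: 'h"] by simp

lemma scaleC_minus_left: "(- c) *\<^sub>C (x::'h::complex_hilbert_space) = - (c *\<^sub>C x)"
  using scaleC_add_left [of c "- c" x] by (simp add: eq_neg_iff_add_eq_0 add.commute)

lemma cinner_scaleC_right: "cinner x (c *\<^sub>C y) = cnj c * cinner (x::'h::complex_hilbert_space) y"
  by (metis cinner_commute cinner_scaleC_left complex_cnj_mult)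

lemma cinner_add_right: "cinner x (y + z) = cinner x y + cinner (x::'h::complex_hilbert_space) z"
  by (metis cinner_add_left cinner_commute complex_cnj_add)

lemma scalar_op_of_real: "scalar_op (complex_of_real r) = r *\<^sub>R id_blinfun"
  by (rule blinfun_eqI) (simp add: op_simps scaleC_of_real)

lemma bounded_opsI:
  "(\<And>c x. blinfun_apply T (c *\<^sub>C x) = c *\<^sub>C blinfun_apply T x) \<Longrightarrow> T \<in> bounded_ops"
  by (simp add: bounded_ops_def)

lemma bounded_opsD: "T \<in> bounded_ops \<Longrightarrow> blinfun_apply T (c *\<^sub>C x) = c *\<^sub>C blinfun_apply T x"
  by (simp add: bounded_ops_def)

lemma bounded_ops_id: "id_blinfun \<in> bounded_ops"
  and bounded_ops_zero: "0 \<in> bounded_ops"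
  and bounded_ops_scalar_op: "scalar_op z \<in> bounded_ops"
  by (auto intro!: bounded_opsI simp: op_simps scaleC_scaleC mult.commute)

lemma bounded_ops_add: "S \<in> bounded_ops \<Longrightarrow> T \<in> bounded_ops \<Longrightarrow> S + T \<in> bounded_ops"
  and bounded_ops_diff: "S \<in> bounded_ops \<Longrightarrow> T \<in> bounded_ops \<Longrightarrow> S - T \<in> bounded_ops"
  and bounded_ops_scaleR: "S \<in> bounded_ops \<Longrightarrow> r *\<^sub>R S \<in> bounded_ops"
  and bounded_ops_compose: "S \<in> bounded_ops \<Longrightarrow> T \<in> bounded_ops \<Longrightarrow> S o\<^sub>L T \<in> bounded_ops"
  by (auto intro!: bounded_opsI
      simp: op_simps bounded_opsD scaleC_add_right scaleC_diff_right scaleC_scaleR_right)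

text \<open>Symmetry is demanded of the real inner product. For complex-linear \<open>T\<close>,
  replacing y by i y yields the imaginary part, so this is self-adjointness for
  \<open>cinner\<close> as well.\<close>

definition self_adjoint :: "'h::complex_hilbert_space op \<Rightarrow> bool"
  where "self_adjoint T \<longleftrightarrow>
    T \<in> bounded_ops \<and> (\<forall>x y. inner (blinfun_apply T x) y = inner x (blinfun_apply T y))"

lemma self_adjointI:
  "T \<in> bounded_ops \<Longrightarrow> (\<And>x y. inner (blinfun_apply T x) y = inner x (blinfun_apply T y)) \<Longrightarrow>
    self_adjoint T"
  by (simp add: self_adjoint_def)

lemma self_adjointD:
  "self_adjoint T \<Longrightarrow> inner (blinfun_apply T x) y = inner x (blinfun_apply T y)"
  by (simp add: self_adjoint_def)

lemma self_adjoint_bounded_ops: "self_adjoint T \<Longrightarrow> T \<in> bounded_ops"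
  by (simp add: self_adjoint_def)

lemma self_adjoint_id: "self_adjoint id_blinfun"
  and self_adjoint_zero: "self_adjoint 0"
  and self_adjoint_add: "self_adjoint S \<Longrightarrow> self_adjoint T \<Longrightarrow> self_adjoint (S + T)"
  and self_adjoint_diff: "self_adjoint S \<Longrightarrow> self_adjoint T \<Longrightarrow> self_adjoint (S - T)"
  and self_adjoint_scaleR: "self_adjoint S \<Longrightarrow> self_adjoint (r *\<^sub>R S)"
  and self_adjoint_sandwich:
    "self_adjoint S \<Longrightarrow> self_adjoint T \<Longrightarrow> self_adjoint (S o\<^sub>L T o\<^sub>L S)"
  and self_adjoint_compose:
    "self_adjoint S \<Longrightarrow> self_adjoint T \<Longrightarrow> S o\<^sub>L T = T o\<^sub>L S \<Longrightarrow> self_adjoint (S o\<^sub>L T)"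
proof -
  show "self_adjoint id_blinfun" "self_adjoint 0"
    by (auto simp: self_adjoint_def bounded_ops_id bounded_ops_zero op_simps)
next
  assume S: "self_adjoint S" and T: "self_adjoint T"
  then show "self_adjoint (S + T)" "self_adjoint (S - T)" "self_adjoint (S o\<^sub>L T o\<^sub>L S)"
    by (auto simp: self_adjoint_def op_simps bounded_ops_add bounded_ops_diff bounded_ops_compose
      inner_add_left inner_add_right inner_diff_left inner_diff_right)
  assume "S o\<^sub>L T = T o\<^sub>L S"
  then have "blinfun_apply S (blinfun_apply T x) = blinfun_apply T (blinfun_apply S x)" for x
    by (metis blinfun_apply_blinfun_compose)
  with S T show "self_adjoint (S o\<^sub>L T)"
    by (auto simp: self_adjoint_def bounded_ops_compose op_simps)
next
  assume "self_adjoint S"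
  then show "self_adjoint (r *\<^sub>R S)"
    by (auto simp: self_adjoint_def op_simps bounded_ops_scaleR)
qed

lemma self_adjoint_LIMSEQ:
  assumes "\<And>n. self_adjoint (X n)" "X \<longlonglongrightarrow> T"
  shows "self_adjoint T"
proof -
  have lim: "(\<lambda>n. blinfun_apply (X n) x) \<longlonglongrightarrow> blinfun_apply T x" for x
    by (intro tendsto_intros assms)
  show ?thesis
  proof (intro self_adjointI bounded_opsI)
    fix c x
    have "(\<lambda>n. scalar_op c (blinfun_apply (X n) x)) \<longlonglongrightarrow> scalar_op c (blinfun_apply T x)"
      by (intro tendsto_intros assms)
    then have "(\<lambda>n. blinfun_apply (X n) (c *\<^sub>C x)) \<longlonglongrightarrow> c *\<^sub>C blinfun_apply T x"
      using assms(1) by (simp add: self_adjoint_bounded_ops bounded_opsD op_simps)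
    with lim [of "c *\<^sub>C x"] show "blinfun_apply T (c *\<^sub>C x) = c *\<^sub>C blinfun_apply T x"
      by (rule LIMSEQ_unique)
  next
    fix x y
    have "(\<lambda>n. inner (blinfun_apply (X n) x) y) \<longlonglongrightarrow> inner (blinfun_apply T x) y"
      by (intro tendsto_intros lim)
    moreover have "(\<lambda>n. inner (blinfun_apply (X n) x) y) \<longlonglongrightarrow> inner x (blinfun_apply T y)"
      unfolding self_adjointD [OF assms(1)] by (intro tendsto_intros lim)
    ultimately show "inner (blinfun_apply T x) y = inner x (blinfun_apply T y)"
      by (rule LIMSEQ_unique)
  qed
qed

lemma Im_cinner:
  fixes x y :: "'h::complex_hilbert_space"
  shows "Im (cinner x y) = inner x (\<i> *\<^sub>C y)"
  by (simp add: Re_cinner [symmetric] cinner_scaleC_right)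

text \<open>A form with nonnegative real values is in particular real, and polarization turns this
  into symmetry. The criterion trades the complex form for the real one, in which the later order
  arguments are carried out.\<close>

lemma pos_ops_iff:
  "T \<in> pos_ops \<longleftrightarrow> self_adjoint T \<and> (\<forall>x. 0 \<le> inner (blinfun_apply T x) x)"
proof
  assume T: "T \<in> pos_ops"
  then have lin: "T \<in> bounded_ops" and re: "\<And>x. cinner (blinfun_apply T x) x \<in> \<real>\<^sub>\<ge>\<^sub>0"
    by (auto simp: pos_ops_def)
  from re have im: "Im (cinner (blinfun_apply T x) x) = 0" for x
    by (simp add: complex_nonneg_Reals_iff)
  have im2: "Im (cinner (blinfun_apply T x) y) + Im (cinner (blinfun_apply T y) x) = 0" for x y
    using im [of "x + y"] im [of x] im [of y]
    by (simp add: op_simps cinner_add_left cinner_add_right)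
  \<comment> \<open>With i x in place of x, the two imaginary parts in \<open>im2\<close> become Re
    <T x, y> and -Re <T y, x>.\<close>
  have "inner (blinfun_apply T x) y = inner x (blinfun_apply T y)" for x y
    using im2 [of "\<i> *\<^sub>C x" y]
    by (simp add: bounded_opsD [OF lin] cinner_scaleC_left cinner_scaleC_right Re_cinner
      inner_commute [of x])
  moreover have "0 \<le> inner (blinfun_apply T x) x" for x
    using re [of x] by (simp add: complex_nonneg_Reals_iff Re_cinner)
  ultimately show "self_adjoint T \<and> (\<forall>x. 0 \<le> inner (blinfun_apply T x) x)"
    using lin by (simp add: self_adjoint_def)
next
  assume T: "self_adjoint T \<and> (\<forall>x. 0 \<le> inner (blinfun_apply T x) x)"
  have lin: "T \<in> bounded_ops" using T by (simp add: self_adjoint_def)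
  have "Im (cinner (blinfun_apply T x) x) = 0" for x
  proof -
    have "Im (cinner (blinfun_apply T x) x) = inner (blinfun_apply T x) (\<i> *\<^sub>C x)"
      by (rule Im_cinner)
    also have "\<dots> = inner (\<i> *\<^sub>C blinfun_apply T x) x"
      by (metis T bounded_opsD lin self_adjointD inner_commute)
    also have "\<dots> = - Im (cinner (blinfun_apply T x) x)"
      by (simp add: Re_cinner [symmetric] cinner_scaleC_left)
    finally show ?thesis by simp
  qed
  then show "T \<in> pos_ops"
    using T lin by (simp add: pos_ops_def complex_nonneg_Reals_iff Re_cinner)
qed

lemma pos_opsI:
  "self_adjoint T \<Longrightarrow> (\<And>x. 0 \<le> inner (blinfun_apply T x) x) \<Longrightarrow> T \<in> pos_ops"
  by (simp add: pos_ops_iff)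

lemma pos_ops_self_adjoint: "T \<in> pos_ops \<Longrightarrow> self_adjoint T"
  and pos_ops_nonneg: "T \<in> pos_ops \<Longrightarrow> 0 \<le> inner (blinfun_apply T x) x"
  by (simp_all add: pos_ops_iff)

lemma pos_ops_add: "S \<in> pos_ops \<Longrightarrow> T \<in> pos_ops \<Longrightarrow> S + T \<in> pos_ops"
  by (simp add: pos_ops_iff self_adjoint_add op_simps inner_add_left)

lemma pos_ops_scaleR: "0 \<le> r \<Longrightarrow> S \<in> pos_ops \<Longrightarrow> r *\<^sub>R S \<in> pos_ops"
  by (simp add: pos_ops_iff self_adjoint_scaleR op_simps)

lemma pos_ops_id: "id_blinfun \<in> pos_ops"
  by (simp add: pos_ops_iff self_adjoint_id)

lemma pos_ops_sandwich: "self_adjoint S \<Longrightarrow> T \<in> pos_ops \<Longrightarrow> S o\<^sub>L T o\<^sub>L S \<in> pos_ops"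
  by (auto simp: pos_ops_iff self_adjoint_sandwich op_simps self_adjointD [of S])

lemma pos_ops_square: "self_adjoint S \<Longrightarrow> S o\<^sub>L S \<in> pos_ops"
proof (rule pos_opsI)
  assume S: "self_adjoint S"
  then show "self_adjoint (S o\<^sub>L S)" by (simp add: self_adjoint_compose)
  show "0 \<le> inner (blinfun_apply (S o\<^sub>L S) x) x" for x
    using self_adjointD [OF S, of "blinfun_apply S x" x] by simp
qed

text \<open>The discriminant argument for the form at x + t y. The degenerate case
  \<open>a = 0\<close> is treated apart: a linear function bounded below has slope zero.\<close>

lemma pos_ops_Cauchy_Schwarz:
  assumes T: "T \<in> pos_ops"
  shows "(inner (blinfun_apply T x) y)\<^sup>2
    \<le> inner (blinfun_apply T x) x * inner (blinfun_apply T y) y"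
proof -
  define a b c where "a = inner (blinfun_apply T y) y" and "b = inner (blinfun_apply T x) y"
    and "c = inner (blinfun_apply T x) x"
  have sym: "inner (blinfun_apply T y) x = b"
    by (metis b_def T inner_commute pos_ops_self_adjoint self_adjointD)
  have quad: "0 \<le> a * t\<^sup>2 + 2 * b * t + c" for t
    using pos_ops_nonneg [OF T, of "x + t *\<^sub>R y"] sym
    by (simp add: op_simps inner_add_left inner_add_right a_def b_def c_def power2_eq_square
      algebra_simps)
  have a: "0 \<le> a" unfolding a_def by (rule pos_ops_nonneg [OF T])
  show ?thesis
  proof (cases "a = 0")
    case True
    have "b = 0"
    proof (rule ccontr)
      assume "b \<noteq> 0"
      \<comment> \<open>At this point 2 b t + c equals -1.\<close>
      with quad [of "- (c + 1) / (2 * b)"] True show False by (simp add: field_simps)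
    qed
    with True show ?thesis by (simp add: a_def b_def)
  next
    case False
    with a have "0 < a" by simp
    have "0 \<le> a * (a * (- b / a)\<^sup>2 + 2 * b * (- b / a) + c)"
      using quad [of "- b / a"] a by (intro mult_nonneg_nonneg)
    also have "\<dots> = a * c - b\<^sup>2" using \<open>0 < a\<close> by (simp add: field_simps power2_eq_square)
    finally show ?thesis by (simp add: a_def b_def c_def mult.commute)
  qed
qed

text \<open>Cauchy-Schwarz for the form of T, taken with y = T x. It converts information about the
  form into information about the vector T x; in particular a vanishing form value forces T x =
  0.\<close>

lemma pos_ops_norm_bound:
  assumes T: "T \<in> pos_ops"
  shows "(norm (blinfun_apply T x))\<^sup>2 \<le> norm T * inner (blinfun_apply T x) x"
proof (cases "blinfun_apply T x = 0")
  case False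
  define y where "y = blinfun_apply T x"
  have "inner (blinfun_apply T y) y \<le> norm (blinfun_apply T y) * norm y"
    by (rule norm_cauchy_schwarz)
  also have "\<dots> \<le> norm T * norm y * norm y"
    by (intro mult_right_mono norm_blinfun) simp
  finally have y: "inner (blinfun_apply T y) y \<le> norm T * (norm y)\<^sup>2"
    by (simp add: power2_eq_square mult.assoc)
  have "((norm y)\<^sup>2)\<^sup>2 \<le> inner (blinfun_apply T x) x * inner (blinfun_apply T y) y"
    using pos_ops_Cauchy_Schwarz [OF T, of x y]
    by (simp add: y_def power2_norm_eq_inner)
  also have "\<dots> \<le> inner (blinfun_apply T x) x * (norm T * (norm y)\<^sup>2)"
    by (intro mult_left_mono y pos_ops_nonneg [OF T])
  finally have "(norm y)\<^sup>2 * (norm y)\<^sup>2 \<le> (norm T * inner (blinfun_apply T x) x) * (norm y)\<^sup>2"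
    by (simp add: power2_eq_square mult_ac)
  moreover have "0 < (norm y)\<^sup>2" using False by (simp add: y_def)
  ultimately show ?thesis unfolding y_def by (rule mult_right_le_imp_le)
qed (simp add: pos_ops_nonneg [OF T])

lemma pos_ops_form_zero:
  assumes "T \<in> pos_ops" "inner (blinfun_apply T x) x = 0"
  shows "blinfun_apply T x = 0"
  using pos_ops_norm_bound [OF assms(1), of x] assms(2) by simp

lemma self_adjoint_form_zero:
  assumes T: "self_adjoint T" and zero: "\<And>x. inner (blinfun_apply T x) x = 0"
  shows "T = 0"
  using pos_ops_form_zero [OF pos_opsI [OF T] zero] zero by (auto intro: blinfun_eqI)

lemma op_le_iff:
  assumes "self_adjoint S" "self_adjoint T"
  shows "S \<preceq> T \<longleftrightarrow> (\<forall>x. inner (blinfun_apply S x) x \<le> inner (blinfun_apply T x) x)"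
  using self_adjoint_diff [OF assms(2,1)]
  by (simp add: op_le_def pos_ops_iff op_simps inner_diff_left)

lemma op_le_antisym:
  assumes "self_adjoint S" "self_adjoint T" "S \<preceq> T" "T \<preceq> S"
  shows "S = T"
  using self_adjoint_form_zero [OF self_adjoint_diff [OF assms(1,2)]] assms
  by (simp add: op_le_iff op_simps inner_diff_left order_antisym)

section \<open>Invertibility and the spectrum\<close>

lemma norm_sq_diff_scaleR:
  fixes x y :: "'a::real_inner"
  shows "(norm (x - t *\<^sub>R y))\<^sup>2 = (norm x)\<^sup>2 - 2 * t * inner y x + t\<^sup>2 * (norm y)\<^sup>2"
  unfolding power2_norm_eq_inner
  by (simp add: inner_diff_left inner_diff_right inner_commute [of x y] power2_eq_square
    right_diff_distrib)

text \<open>Solving S x = y means finding a fixed point of x - \<tau> (S x - y), a contraction in x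
  for suitable \<tau>. Coercivity also makes S injective and bounds the inverse by 1/c.\<close>

lemma Lax_Milgram:
  fixes S :: "'h::complex_hilbert_space op"
  assumes lin: "S \<in> bounded_ops" and "0 < c"
    and coercive: "\<And>x. c * (norm x)\<^sup>2 \<le> inner (blinfun_apply S x) x"
  shows "invertible_op S"
proof -
  \<comment> \<open>Adding c to the norm guarantees M > 0 and c \<le> M, so that q is real. The
    value \<tau> = c/M^2 minimizes 1 - 2 \<tau> c + \<tau>^2 M^2, and q^2 is the minimum.\<close>
  define M where "M = norm S + c"
  have M: "0 < M" "norm S \<le> M" "c \<le> M" using \<open>0 < c\<close> by (auto simp: M_def add_nonneg_pos)
  define \<tau> where "\<tau> = c / M\<^sup>2"
  define q where "q = sqrt (1 - c\<^sup>2 / M\<^sup>2)"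
  have "c\<^sup>2 / M\<^sup>2 \<le> 1" using M \<open>0 < c\<close> by (simp add: divide_le_eq_1 power_mono)
  then have q: "0 \<le> q" "q < 1" "q\<^sup>2 = 1 - c\<^sup>2 / M\<^sup>2" using M \<open>0 < c\<close> by (auto simp: q_def)
  have \<tau>: "0 < \<tau>" using M \<open>0 < c\<close> by (simp add: \<tau>_def)
  have contr: "norm (x - \<tau> *\<^sub>R blinfun_apply S x) \<le> q * norm x" for x
  proof (rule power2_le_imp_le)
    have "norm (blinfun_apply S x) \<le> M * norm x"
      using norm_blinfun [of S x] mult_right_mono [OF M(2), of "norm x"] by simp
    then have nS: "(norm (blinfun_apply S x))\<^sup>2 \<le> M\<^sup>2 * (norm x)\<^sup>2"
      by (metis norm_ge_zero power_mono power_mult_distrib)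
    have "(norm (x - \<tau> *\<^sub>R blinfun_apply S x))\<^sup>2
        = (norm x)\<^sup>2 - 2 * \<tau> * inner (blinfun_apply S x) x + \<tau>\<^sup>2 * (norm (blinfun_apply S x))\<^sup>2"
      by (rule norm_sq_diff_scaleR)
    also have "\<dots> \<le> (norm x)\<^sup>2 - 2 * \<tau> * (c * (norm x)\<^sup>2) + \<tau>\<^sup>2 * (M\<^sup>2 * (norm x)\<^sup>2)"
      using \<tau> by (intro add_mono diff_mono mult_left_mono coercive nS) auto
    also have "\<dots> = (q * norm x)\<^sup>2"
      unfolding power_mult_distrib q(3) using M
      by (simp add: \<tau>_def field_simps power2_eq_square)
    finally show "(norm (x - \<tau> *\<^sub>R blinfun_apply S x))\<^sup>2 \<le> (q * norm x)\<^sup>2" .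
  qed (use q in simp)
  have surj: "\<exists>x. blinfun_apply S x = y" for y
  proof -
    have "\<exists>!x. x - \<tau> *\<^sub>R (blinfun_apply S x - y) = x"
    proof (rule banach_fix_type [OF q(1,2)], intro allI)
      fix u v
      have eq: "u - \<tau> *\<^sub>R (blinfun_apply S u - y) - (v - \<tau> *\<^sub>R (blinfun_apply S v - y))
        = (u - v) - \<tau> *\<^sub>R blinfun_apply S (u - v)"
        by (simp add: op_simps algebra_simps)
      show "dist (u - \<tau> *\<^sub>R (blinfun_apply S u - y)) (v - \<tau> *\<^sub>R (blinfun_apply S v - y))
        \<le> q * dist u v"
        unfolding dist_norm eq by (rule contr)
    qed
    then show ?thesis using \<tau> by auto
  qed
  have below: "c * norm x \<le> norm (blinfun_apply S x)" for x
  proof (cases "x = 0")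
    case False
    have "c * norm x * norm x \<le> norm (blinfun_apply S x) * norm x"
      using coercive [of x] norm_cauchy_schwarz [of "blinfun_apply S x" x]
      by (simp add: power2_eq_square mult.assoc)
    with False show ?thesis by simp
  qed simp
  have inj: "x = y" if "blinfun_apply S x = blinfun_apply S y" for x y
    using below [of "x - y"] that \<open>0 < c\<close> by (simp add: op_simps zero_less_mult_iff mult_le_0_iff)
  obtain R where R: "\<And>y. blinfun_apply S (R y) = y" using surj by metis
  have "bounded_linear R"
  proof (rule bounded_linear_intro)
    show "R (x + y) = R x + R y" for x y by (rule inj) (simp add: R op_simps)
    show "R (r *\<^sub>R x) = r *\<^sub>R R x" for r x by (rule inj) (simp add: R op_simps)
    show "norm (R x) \<le> norm x * (1 / c)" for x
      using below [of "R x"] \<open>0 < c\<close> by (simp add: R field_simps)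
  qed
  then have ap: "blinfun_apply (Blinfun R) = R" by (rule bounded_linear_Blinfun_apply)
  show ?thesis unfolding invertible_op_def
  proof (intro bexI conjI)
    show "S o\<^sub>L Blinfun R = id_blinfun"
      by (rule blinfun_eqI) (simp add: ap R)
    show "Blinfun R o\<^sub>L S = id_blinfun"
      by (rule blinfun_eqI, rule inj) (simp add: ap R)
    show "Blinfun R \<in> bounded_ops"
      by (rule bounded_opsI, rule inj) (simp add: ap R bounded_opsD [OF lin])
  qed
qed

text \<open>For self-adjoint operators this is equivalent to invertibility, which turns spectral
  questions into norm estimates. It is defined for arbitrary maps so that shifts and compositions
  can be written as plain functions.\<close>

definition bounded_below :: "('h::real_normed_vector \<Rightarrow> 'h) \<Rightarrow> bool"
  where "bounded_below F \<longleftrightarrow> (\<exists>c>0. \<forall>x. c * norm x \<le> norm (F x))"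

lemma bounded_belowI: "0 < c \<Longrightarrow> (\<And>x. c * norm x \<le> norm (F x)) \<Longrightarrow> bounded_below F"
  by (auto simp: bounded_below_def)

lemma bounded_below_comp:
  assumes "bounded_below F" "bounded_below G"
  shows "bounded_below (\<lambda>x. F (G x))"
proof -
  obtain c d where c: "0 < c" "\<And>x. c * norm x \<le> norm (F x)"
    and d: "0 < d" "\<And>x. d * norm x \<le> norm (G x)"
    using assms by (auto simp: bounded_below_def)
  have "(c * d) * norm x \<le> norm (F (G x))" for x
    using order_trans [OF mult_left_mono [OF d(2) [of x], of c] c(2) [of "G x"]] c(1)
    by (simp add: mult.assoc)
  then show ?thesis using c(1) d(1) by (intro bounded_belowI [of "c * d"]) auto
qed

lemma invertible_op_bounded_below:
  assumes "invertible_op T"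
  shows "bounded_below (blinfun_apply T)"
proof -
  obtain S where S: "S o\<^sub>L T = id_blinfun" using assms by (auto simp: invertible_op_def)
  have "(1 / (norm S + 1)) * norm x \<le> norm (blinfun_apply T x)" for x
  proof -
    have "norm x = norm (blinfun_apply S (blinfun_apply T x))"
      by (metis S blinfun_apply_blinfun_compose blinfun_apply_id_blinfun)
    also have "\<dots> \<le> norm S * norm (blinfun_apply T x)" by (rule norm_blinfun)
    also have "\<dots> \<le> (norm S + 1) * norm (blinfun_apply T x)" by (intro mult_right_mono) auto
    finally have "norm x \<le> norm (blinfun_apply T x) * (norm S + 1)" by (simp add: mult.commute)
    moreover have "0 < norm S + 1" by (simp add: add_nonneg_pos)
    ultimately show ?thesis by (simp add: pos_divide_le_eq)
  qed
  then show ?thesis by (intro bounded_belowI [of "1 / (norm S + 1)"]) (auto simp: add_nonneg_pos)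
qed

text \<open>If R inverts S T and the factors commute, then T R is a two-sided inverse of S.
  Invertibility can thus be checked on a coercive product.\<close>

lemma invertible_op_factor:
  assumes "S \<in> bounded_ops" "T \<in> bounded_ops" and comm: "S o\<^sub>L T = T o\<^sub>L S"
    and "invertible_op (S o\<^sub>L T)"
  shows "invertible_op S"
proof -
  obtain R where R: "R \<in> bounded_ops" "R o\<^sub>L (S o\<^sub>L T) = id_blinfun" "(S o\<^sub>L T) o\<^sub>L R = id_blinfun"
    using assms by (auto simp: invertible_op_def)
  have 1: "R (S (T x)) = x" "S (T (R x)) = x" for x
    using R by (metis blinfun_apply_blinfun_compose blinfun_apply_id_blinfun)+
  have 2: "S (T x) = T (S x)" for x using comm by (metis blinfun_apply_blinfun_compose)
  have "(T o\<^sub>L R) o\<^sub>L S = id_blinfun"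
    by (rule blinfun_eqI) (metis 1 2 blinfun_apply_blinfun_compose blinfun_apply_id_blinfun)
  moreover have "S o\<^sub>L (T o\<^sub>L R) = id_blinfun"
    by (rule blinfun_eqI) (simp add: 1)
  ultimately show ?thesis
    using assms(2) R(1) bounded_ops_compose unfolding invertible_op_def by blast
qed

text \<open>Since <T T x, x> = |T x|^2, a lower bound for T is coercivity of T T; invertibility then
  passes to the factor T.\<close>

lemma self_adjoint_invertible_iff:
  assumes T: "self_adjoint T"
  shows "invertible_op T \<longleftrightarrow> bounded_below (blinfun_apply T)"
proof
  assume "bounded_below (blinfun_apply T)"
  then obtain c where c: "0 < c" "\<And>x. c * norm x \<le> norm (blinfun_apply T x)"
    by (auto simp: bounded_below_def)
  have "c\<^sup>2 * (norm x)\<^sup>2 \<le> inner (blinfun_apply (T o\<^sub>L T) x) x" for x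
  proof -
    have "(c * norm x)\<^sup>2 \<le> (norm (blinfun_apply T x))\<^sup>2"
      using c by (intro power_mono) auto
    also have "\<dots> = inner (blinfun_apply (T o\<^sub>L T) x) x"
      by (simp add: power2_norm_eq_inner self_adjointD [OF T])
    finally show ?thesis by (simp add: power_mult_distrib)
  qed
  then have "invertible_op (T o\<^sub>L T)"
    using c T by (intro Lax_Milgram [of _ "c\<^sup>2"])
      (auto simp: bounded_ops_compose self_adjoint_bounded_ops)
  then show "invertible_op T"
    using T by (intro invertible_op_factor [of T T]) (auto simp: self_adjoint_bounded_ops)
qed (rule invertible_op_bounded_below)

definition real_spectrum :: "'h::complex_hilbert_space op \<Rightarrow> real set"
  where "real_spectrum A = {r. complex_of_real r \<in> spectrum A}"

lemma real_spectrum_iff: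
  assumes "self_adjoint A"
  shows "r \<in> real_spectrum A \<longleftrightarrow> \<not> bounded_below (\<lambda>x. blinfun_apply A x - r *\<^sub>R x)"
proof -
  have "blinfun_apply (A - r *\<^sub>R id_blinfun) = (\<lambda>x. blinfun_apply A x - r *\<^sub>R x)"
    by (auto simp: op_simps)
  with self_adjoint_invertible_iff [of "A - r *\<^sub>R id_blinfun"] assms show ?thesis
    by (simp add: real_spectrum_def spectrum_def scalar_op_of_real self_adjoint_diff
        self_adjoint_scaleR self_adjoint_id)
qed

text \<open>The product (A - z)(A - cnj z) = (A - Re z)^2 + (Im z)^2 is coercive with constant (Im
  z)^2.\<close>

lemma invertible_op_nonreal:
  assumes A: "self_adjoint A" and "Im z \<noteq> 0"
  shows "invertible_op (A - scalar_op z)"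
proof (rule invertible_op_factor)
  have lin: "A \<in> bounded_ops" using A by (rule self_adjoint_bounded_ops)
  then show b: "A - scalar_op z \<in> bounded_ops" "A - scalar_op (cnj z) \<in> bounded_ops"
    by (auto intro: bounded_ops_diff bounded_ops_scalar_op)
  have zz: "z *\<^sub>C x + cnj z *\<^sub>C x = (2 * Re z) *\<^sub>R x" for x :: 'a
    unfolding scaleC_add_left [symmetric] complex_add_cnj scaleC_of_real ..
  have zz': "z *\<^sub>C cnj z *\<^sub>C x = (cmod z)\<^sup>2 *\<^sub>R x" for x :: 'a
    unfolding scaleC_scaleC complex_mult_cnj cmod_power2 scaleC_of_real ..
  show "(A - scalar_op z) o\<^sub>L (A - scalar_op (cnj z)) = (A - scalar_op (cnj z)) o\<^sub>L (A - scalar_op z)"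
    by (rule blinfun_eqI)
      (simp add: op_simps bounded_opsD [OF lin] scaleC_diff_right scaleC_scaleC mult.commute)
  have exp: "blinfun_apply ((A - scalar_op z) o\<^sub>L (A - scalar_op (cnj z))) x
    = blinfun_apply A (blinfun_apply A x) - (2 * Re z) *\<^sub>R blinfun_apply A x + (cmod z)\<^sup>2 *\<^sub>R x" for x
    unfolding zz [symmetric] zz' [symmetric]
    by (simp add: op_simps bounded_opsD [OF lin] scaleC_diff_right)
  show "invertible_op ((A - scalar_op z) o\<^sub>L (A - scalar_op (cnj z)))"
  proof (rule Lax_Milgram)
    show "(A - scalar_op z) o\<^sub>L (A - scalar_op (cnj z)) \<in> bounded_ops"
      by (intro bounded_ops_compose b)
    show "0 < (Im z)\<^sup>2" using assms by simp
    fix x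
    have "inner (blinfun_apply ((A - scalar_op z) o\<^sub>L (A - scalar_op (cnj z))) x) x
      = (norm (blinfun_apply A x - Re z *\<^sub>R x))\<^sup>2 + (Im z)\<^sup>2 * (norm x)\<^sup>2"
      unfolding exp norm_sq_diff_scaleR
      by (simp add: inner_diff_left inner_add_left self_adjointD [OF A, of "blinfun_apply A x" x]
        dot_square_norm inner_commute [of x] cmod_power2 distrib_right)
    then show "(Im z)\<^sup>2 * (norm x)\<^sup>2
      \<le> inner (blinfun_apply ((A - scalar_op z) o\<^sub>L (A - scalar_op (cnj z))) x) x" by simp
  qed
qed

lemma spectrum_self_adjoint:
  assumes "self_adjoint A"
  shows "spectrum A = complex_of_real ` real_spectrum A"
proof -
  have "z \<in> complex_of_real ` real_spectrum A" if "z \<in> spectrum A" for z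
  proof -
    have "Im z = 0" using invertible_op_nonreal [OF assms, of z] that by (auto simp: spectrum_def)
    then have "z = complex_of_real (Re z)" by (simp add: complex_eq_iff)
    with that show ?thesis unfolding real_spectrum_def by (metis (mono_tags) imageI mem_Collect_eq)
  qed
  then show ?thesis by (auto simp: real_spectrum_def)
qed

lemma real_spectrum_le_norm:
  assumes A: "self_adjoint A" and "r \<in> real_spectrum A"
  shows "\<bar>r\<bar> \<le> norm A"
proof (rule ccontr)
  assume "\<not> \<bar>r\<bar> \<le> norm A"
  then have "bounded_below (\<lambda>x. blinfun_apply A x - r *\<^sub>R x)"
  proof (intro bounded_belowI [of "\<bar>r\<bar> - norm A"])
    fix x
    have "\<bar>r\<bar> * norm x \<le> norm (blinfun_apply A x - r *\<^sub>R x) + norm (blinfun_apply A x)"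
      using norm_triangle_ineq4 [of "blinfun_apply A x" "blinfun_apply A x - r *\<^sub>R x"] by simp
    with norm_blinfun [of A x]
    show "(\<bar>r\<bar> - norm A) * norm x \<le> norm (blinfun_apply A x - r *\<^sub>R x)"
      by (simp add: algebra_simps)
  qed simp
  with assms show False by (simp add: real_spectrum_iff)
qed

text \<open>A lower bound c at r leaves the lower bound c - |s - r| at s, so the complement of the
  spectrum is open.\<close>

lemma compact_real_spectrum:
  assumes A: "self_adjoint A"
  shows "compact (real_spectrum A)"
proof -
  have "open (- real_spectrum A)"
    unfolding open_dist
  proof
    fix r assume "r \<in> - real_spectrum A"
    then obtain c where c: "0 < c" "\<And>x. c * norm x \<le> norm (blinfun_apply A x - r *\<^sub>R x)"
      using real_spectrum_iff [OF A] by (auto simp: bounded_below_def)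
    have "s \<in> - real_spectrum A" if "dist s r < c" for s
    proof -
      have "(c - \<bar>s - r\<bar>) * norm x \<le> norm (blinfun_apply A x - s *\<^sub>R x)" for x
      proof -
        have "norm (blinfun_apply A x - r *\<^sub>R x)
            \<le> norm (blinfun_apply A x - s *\<^sub>R x) + norm ((s - r) *\<^sub>R x)"
          using norm_triangle_ineq [of "blinfun_apply A x - s *\<^sub>R x" "(s - r) *\<^sub>R x"]
          by (simp add: scaleR_diff_left)
        with c(2) [of x] show ?thesis by (simp add: left_diff_distrib)
      qed
      with that have "bounded_below (\<lambda>x. blinfun_apply A x - s *\<^sub>R x)"
        by (intro bounded_belowI [of "c - \<bar>s - r\<bar>"]) (auto simp: dist_real_def)
      then show ?thesis using real_spectrum_iff [OF A] by auto
    qed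
    with c(1) show "\<exists>e>0. \<forall>s. dist s r < e \<longrightarrow> s \<in> - real_spectrum A" by auto
  qed
  moreover have "bounded (real_spectrum A)"
    using real_spectrum_le_norm [OF A] unfolding bounded_iff by auto
  ultimately show ?thesis by (simp add: compact_eq_bounded_closed closed_def)
qed

lemma real_spectrum_pos:
  assumes A: "A \<in> pos_ops" and "r \<in> real_spectrum A"
  shows "0 \<le> r"
proof (rule ccontr)
  assume r: "\<not> 0 \<le> r"
  have "bounded_below (\<lambda>x. blinfun_apply A x - r *\<^sub>R x)"
  proof (rule bounded_belowI)
    show "0 < - r" using r by simp
    fix x
    show "- r * norm x \<le> norm (blinfun_apply A x - r *\<^sub>R x)"
    proof (cases "x = 0")
      case False
      have "- r * norm x * norm x \<le> inner (blinfun_apply A x - r *\<^sub>R x) x"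
        using pos_ops_nonneg [OF A, of x]
        by (simp add: inner_diff_left dot_square_norm power2_eq_square)
      also have "\<dots> \<le> norm (blinfun_apply A x - r *\<^sub>R x) * norm x" by (rule norm_cauchy_schwarz)
      finally show ?thesis by (rule mult_right_le_imp_le) (use False in simp)
    qed simp
  qed
  with assms show False by (simp add: real_spectrum_iff pos_ops_self_adjoint)
qed

section \<open>Continuous functional calculus\<close>

lemma poly_op_altdef:
  assumes "degree p \<le> n"
  shows "poly_op p A = (\<Sum>i\<le>n. coeff p i *\<^sub>R ((o\<^sub>L) A ^^ i) id_blinfun)"
  unfolding poly_op_def using assms
  by (intro sum.mono_neutral_left) (auto simp: coeff_eq_0)

lemma poly_op_0 [simp]: "poly_op 0 A = 0"
  by (simp add: poly_op_def)

lemma poly_op_pCons [simp]: "poly_op (pCons c p) A = c *\<^sub>R id_blinfun + (A o\<^sub>L poly_op p A)"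
proof -
  have "poly_op (pCons c p) A
      = (\<Sum>i\<le>Suc (degree p). coeff (pCons c p) i *\<^sub>R ((o\<^sub>L) A ^^ i) id_blinfun)"
    by (rule poly_op_altdef) (rule degree_pCons_le)
  also have "\<dots> = c *\<^sub>R id_blinfun + (\<Sum>i\<le>degree p. coeff p i *\<^sub>R (A o\<^sub>L ((o\<^sub>L) A ^^ i) id_blinfun))"
    by (subst sum.atMost_Suc_shift) simp
  also have "(\<Sum>i\<le>degree p. coeff p i *\<^sub>R (A o\<^sub>L ((o\<^sub>L) A ^^ i) id_blinfun)) = A o\<^sub>L poly_op p A"
    unfolding poly_op_def
    by (simp add: bounded_bilinear.sum_right [OF bounded_bilinear_blinfun_compose]
        bounded_bilinear.scaleR_right [OF bounded_bilinear_blinfun_compose])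
  finally show ?thesis .
qed

lemma poly_op_add: "poly_op (p + q) A = poly_op p A + poly_op q A"
  by (induction p q rule: poly_induct2) (auto intro!: blinfun_eqI simp: op_simps scaleR_add_left)

lemma poly_op_smult: "poly_op (smult c p) A = c *\<^sub>R poly_op p A"
  by (induction p) (auto intro!: blinfun_eqI simp: op_simps scaleR_add_right)

lemma poly_op_diff: "poly_op (p - q) A = poly_op p A - poly_op q A"
  using poly_op_add [of p "smult (-1) q" A] poly_op_smult [of "-1" q A] by simp

lemma poly_op_mult: "poly_op (p * q) A = poly_op p A o\<^sub>L poly_op q A"
  by (induction p) (auto intro!: blinfun_eqI simp: op_simps poly_op_add poly_op_smult)

lemma self_adjoint_poly_op:
  assumes A: "self_adjoint A"
  shows "self_adjoint (poly_op p A)"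
proof (induction p)
  case (pCons c p)
  \<comment> \<open>A and p(A) commute because both are polynomials in A; their product is therefore
    self-adjoint.\<close>
  have "poly_op [:0, 1:] A = A" by (simp add: blinfun_eqI)
  then have "A o\<^sub>L poly_op p A = poly_op p A o\<^sub>L A"
    by (metis mult.commute poly_op_mult)
  then have "self_adjoint (A o\<^sub>L poly_op p A)"
    by (intro self_adjoint_compose A pCons.IH)
  then show ?case
    by (simp add: self_adjoint_add self_adjoint_scaleR self_adjoint_id)
qed (simp add: self_adjoint_zero)

section \<open>Complex polynomials, which split into linear factors\<close>

definition cpoly_op :: "complex poly \<Rightarrow> 'h::complex_hilbert_space op \<Rightarrow> 'h op"
  where "cpoly_op q A = foldr (\<lambda>c T. scalar_op c + (A o\<^sub>L T)) (coeffs q) 0"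

lemma scalar_op_0 [simp]: "scalar_op 0 = 0"
  by (rule blinfun_eqI) (simp add: op_simps)

lemma cpoly_op_0 [simp]: "cpoly_op 0 A = 0"
  by (simp add: cpoly_op_def)

lemma cpoly_op_pCons [simp]: "cpoly_op (pCons c q) A = scalar_op c + (A o\<^sub>L cpoly_op q A)"
  by (cases "c = 0 \<and> q = 0") (auto simp: cpoly_op_def cCons_def)

lemma cpoly_op_add: "cpoly_op (p + q) A = cpoly_op p A + cpoly_op q A"
  by (induction p q rule: poly_induct2) (auto intro!: blinfun_eqI simp: op_simps scaleC_add_left)

lemma cpoly_op_smult:
  assumes "A \<in> bounded_ops"
  shows "cpoly_op (smult c q) A = scalar_op c o\<^sub>L cpoly_op q A"
  by (induction q)
    (auto intro!: blinfun_eqI simp: op_simps scaleC_add_right scaleC_scaleC bounded_opsD [OF assms])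

lemma cpoly_op_of_real: "cpoly_op (map_poly complex_of_real p) A = poly_op p A"
  by (induction p) (auto simp: map_poly_pCons scalar_op_of_real)

lemma cpoly_op_linear_factor:
  assumes "A \<in> bounded_ops"
  shows "cpoly_op ([:- z, 1:] * q) A = (A - scalar_op z) o\<^sub>L cpoly_op q A"
proof -
  have "[:- z, 1:] * q = smult (- z) q + pCons 0 q" by simp
  then show ?thesis
    by (simp only: cpoly_op_add cpoly_op_smult [OF assms] cpoly_op_pCons)
      (rule blinfun_eqI, simp add: op_simps scaleC_minus_left)
qed

text \<open>One half of the spectral mapping theorem, by splitting off roots: each factor A - z with
  z outside the spectrum is bounded below, and so is the nonzero constant left at the end.\<close>

lemma cpoly_op_bounded_below:
  assumes A: "self_adjoint A" and "q \<noteq> 0"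
    and "\<And>z. poly q z = 0 \<Longrightarrow> z \<notin> spectrum A"
  shows "bounded_below (blinfun_apply (cpoly_op q A))"
  using assms(2,3)
proof (induction "degree q" arbitrary: q rule: less_induct)
  case less
  show ?case
  proof (cases "\<exists>z. poly q z = 0")
    case True
    then obtain z r where z: "poly q z = 0" and q: "q = [:- z, 1:] * r"
      by (auto simp: poly_eq_0_iff_dvd elim: dvdE)
    have r: "r \<noteq> 0" using less.prems(1) q by auto
    have "degree q = Suc (degree r)" unfolding q using r by (subst degree_mult_eq) auto
    then have "bounded_below (blinfun_apply (cpoly_op r A))"
      using less.prems(2) q r by (intro less.hyps) auto
    moreover have "bounded_below (blinfun_apply (A - scalar_op z))"
      using less.prems(2) [OF z] by (intro invertible_op_bounded_below) (simp add: spectrum_def)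
    ultimately have "bounded_below (\<lambda>x. (A - scalar_op z) (cpoly_op r A x))"
      by (rule bounded_below_comp [rotated])
    then show ?thesis
      by (simp add: q cpoly_op_linear_factor [OF self_adjoint_bounded_ops [OF A]]
        blinfun_compose.rep_eq comp_def del: mult_pCons_left)
  next
    case False
    then obtain a where a: "a \<noteq> 0" "q = [:a:]"
      using fundamental_theorem_of_algebra_alt [of q] by auto
    then show ?thesis
      by (intro bounded_belowI [of "cmod a"]) (auto simp: op_simps norm_scaleC)
  qed
qed

lemma poly_map_of_real:
  "poly (map_poly complex_of_real p) (complex_of_real r) = complex_of_real (poly p r)"
  by (induction p) (auto simp: map_poly_pCons)

text \<open>If neither sign occurred, (S - L)(S + L) would be bounded below, so the positive
  operator Q = L^2 - S^2 would satisfy c^2 |x|^2 \<le> |Q x|^2 \<le> |Q| <Q x, x>. Then |S x|^2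
  \<le> (L^2 - c^2/K) |x|^2, contradicting that L is the norm of S. On the zero space the spectrum
  is empty, hence the nonzero vector.\<close>

lemma norm_in_real_spectrum:
  fixes S :: "'h::complex_hilbert_space op"
  assumes S: "self_adjoint S" and nontriv: "\<exists>x::'h. x \<noteq> 0"
  shows "norm S \<in> real_spectrum S \<or> - norm S \<in> real_spectrum S"
proof (rule ccontr)
  define L where "L = norm S"
  assume "\<not> ?thesis"
  then have "bounded_below (\<lambda>x. S x - L *\<^sub>R x)" "bounded_below (\<lambda>x. S x - (- L) *\<^sub>R x)"
    by (auto simp: real_spectrum_iff [OF S] L_def)
  then have "bounded_below (\<lambda>x. S (S x - (- L) *\<^sub>R x) - L *\<^sub>R (S x - (- L) *\<^sub>R x))"
    by (rule bounded_below_comp)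
  then obtain c where c: "0 < c"
    and "\<And>x. c * norm x \<le> norm (S (S x - (- L) *\<^sub>R x) - L *\<^sub>R (S x - (- L) *\<^sub>R x))"
    by (auto simp: bounded_below_def)
  moreover have "S (S x - (- L) *\<^sub>R x) - L *\<^sub>R (S x - (- L) *\<^sub>R x) = - (L\<^sup>2 *\<^sub>R x - S (S x))" for x
    by (simp add: op_simps scaleR_add_right power2_eq_square)
  ultimately have below: "c * norm x \<le> norm (L\<^sup>2 *\<^sub>R x - S (S x))" for x
    by (metis norm_minus_cancel)
  define Q where "Q = L\<^sup>2 *\<^sub>R id_blinfun - (S o\<^sub>L S)"
  have Qx: "inner (Q x) x = L\<^sup>2 * (norm x)\<^sup>2 - (norm (S x))\<^sup>2" for x
    by (simp add: Q_def op_simps inner_diff_left self_adjointD [OF S, of "S x" x] power2_norm_eq_inner)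
  have "Q \<in> pos_ops"
  proof (rule pos_opsI)
    show "self_adjoint Q" unfolding Q_def
      by (intro self_adjoint_diff self_adjoint_scaleR self_adjoint_id self_adjoint_compose S refl)
    fix x
    have "(norm (S x))\<^sup>2 \<le> (L * norm x)\<^sup>2" unfolding L_def by (intro power_mono norm_blinfun) simp
    then show "0 \<le> inner (Q x) x" by (simp add: Qx power_mult_distrib)
  qed
  then have Q: "(norm (Q x))\<^sup>2 \<le> norm Q * inner (Q x) x" and Qpos: "0 \<le> inner (Q x) x" for x
    by (auto simp: pos_ops_norm_bound pos_ops_nonneg)
  define K where "K = norm Q + 1"
  have K: "0 < K" by (simp add: K_def add_nonneg_pos)
  define d where "d = L\<^sup>2 - c\<^sup>2 / K"
  have bound: "(norm (S x))\<^sup>2 \<le> d * (norm x)\<^sup>2" for x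
  proof -
    have "c\<^sup>2 * (norm x)\<^sup>2 \<le> (norm (Q x))\<^sup>2"
      using below [of x] c by (simp add: Q_def op_simps flip: power_mult_distrib)
    also have "\<dots> \<le> norm Q * inner (Q x) x" by (rule Q)
    also have "\<dots> \<le> K * inner (Q x) x" unfolding K_def by (intro mult_right_mono Qpos) simp
    finally have "c\<^sup>2 * (norm x)\<^sup>2 / K \<le> L\<^sup>2 * (norm x)\<^sup>2 - (norm (S x))\<^sup>2"
      using K by (simp add: Qx pos_divide_le_eq mult.commute)
    then show ?thesis by (simp add: d_def left_diff_distrib)
  qed
  obtain x :: 'h where "x \<noteq> 0" using nontriv by auto
  with bound [of x] have d: "0 \<le> d"
    by (metis norm_eq_zero order_trans zero_le_mult_iff zero_le_power2 power2_less_eq_zero_iff linorder_not_less)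
  have "L \<le> sqrt d" unfolding L_def
  proof (rule norm_blinfun_bound)
    show "norm (S x) \<le> sqrt d * norm x" for x
      by (rule power2_le_imp_le) (use bound [of x] d in \<open>auto simp: power_mult_distrib\<close>)
  qed (simp add: d)
  then have "L\<^sup>2 \<le> (sqrt d)\<^sup>2" unfolding L_def by (intro power_mono) auto
  with d K c show False by (simp add: d_def divide_le_0_iff)
qed

text \<open>The norm L of p(A) lies, up to sign, in the spectrum of p(A). If L exceeded e, neither p
  - L nor p + L would have a zero on the spectrum of A, and both signs would be excluded. This bound
  makes the continuous calculus converge.\<close>

lemma poly_op_norm_le:
  fixes A :: "'h::complex_hilbert_space op"
  assumes A: "self_adjoint A" and e: "0 \<le> e"
    and le: "\<And>r. r \<in> real_spectrum A \<Longrightarrow> \<bar>poly p r\<bar> \<le> e"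
  shows "norm (poly_op p A) \<le> e"
proof (rule ccontr)
  define L where "L = norm (poly_op p A)"
  assume "\<not> ?thesis"
  then have L: "e < L" by (simp add: L_def)
  have nontriv: "\<exists>x::'h. x \<noteq> 0"
  proof (rule ccontr)
    assume "\<not> (\<exists>x::'h. x \<noteq> 0)"
    then have "poly_op p A = 0" by (intro blinfun_eqI) metis
    with L e show False by (simp add: L_def)
  qed
  \<comment> \<open>A spectral point ensures that a polynomial without zeros on the spectrum is not
    the zero polynomial.\<close>
  then obtain r0 where r0: "r0 \<in> real_spectrum A"
    using norm_in_real_spectrum [OF A] by auto
  have bb: "bounded_below (blinfun_apply (poly_op q A))"
    if "\<And>r. r \<in> real_spectrum A \<Longrightarrow> poly q r \<noteq> 0" for q
    unfolding cpoly_op_of_real [symmetric]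
  proof (rule cpoly_op_bounded_below [OF A])
    show "map_poly complex_of_real q \<noteq> 0" using that [OF r0] by (auto simp: map_poly_eq_0_iff)
    fix z assume z: "poly (map_poly complex_of_real q) z = 0"
    show "z \<notin> spectrum A"
      using that z by (auto simp: spectrum_self_adjoint [OF A] poly_map_of_real)
  qed
  have s: "self_adjoint (poly_op p A)" by (rule self_adjoint_poly_op [OF A])
  have "bounded_below (blinfun_apply (poly_op (p - [:L:]) A))"
    "bounded_below (blinfun_apply (poly_op (p - [:- L:]) A))"
    using le L e by (auto intro!: bb; fastforce)+
  moreover have "blinfun_apply (poly_op (p - [:r:]) A) = (\<lambda>x. poly_op p A x - r *\<^sub>R x)" for r
    by (auto simp: poly_op_diff op_simps)
  ultimately show False
    using norm_in_real_spectrum [OF s nontriv] by (auto simp: real_spectrum_iff [OF s] L_def)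
qed

section \<open>Continuous functions of a self-adjoint operator\<close>

lemma uniform_limit_polynomials:
  fixes f :: "real \<Rightarrow> real"
  assumes "compact K" "continuous_on K f"
  shows "\<exists>p :: nat \<Rightarrow> real poly. uniform_limit K (\<lambda>n. poly (p n)) f sequentially"
proof -
  have "\<exists>q :: real poly. \<forall>x\<in>K. \<bar>f x - poly q x\<bar> < e" if "0 < e" for e
  proof -
    obtain g where g: "real_polynomial_function g" "\<And>x. x \<in> K \<Longrightarrow> \<bar>f x - g x\<bar> < e"
      using Stone_Weierstrass_real_polynomial_function [OF assms \<open>0 < e\<close>] by blast
    from g(1) obtain a n where "g = (\<lambda>x. \<Sum>i\<le>n. a i * x ^ i)"
      by (auto simp: real_polynomial_function_iff_sum)
    then have "poly (\<Sum>i\<le>n. monom (a i) i) x = g x" for x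
      by (simp add: poly_sum poly_monom)
    with g(2) show ?thesis by metis
  qed
  then have "\<exists>q :: real poly. \<forall>x\<in>K. \<bar>f x - poly q x\<bar> < 1 / Suc n" for n by simp
  then obtain p :: "nat \<Rightarrow> real poly" where p: "\<And>n x. x \<in> K \<Longrightarrow> \<bar>f x - poly (p n) x\<bar> < 1 / Suc n"
    by metis
  have "uniform_limit K (\<lambda>n. poly (p n)) f sequentially"
    unfolding uniform_limit_sequentially_iff
  proof (intro allI impI)
    fix e :: real assume "0 < e"
    then obtain N where N: "inverse (Suc N) < e" using reals_Archimedean by blast
    have "dist (poly (p n) x) (f x) < e" if "n \<ge> N" "x \<in> K" for n x
    proof -
      have "1 / Suc n \<le> inverse (Suc N)" using that(1) by (simp add: field_simps)
      then show ?thesis using p [OF that(2), of n] N by (simp add: dist_real_def abs_minus_commute)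
    qed
    then show "\<exists>N. \<forall>n\<ge>N. \<forall>x\<in>K. dist (poly (p n) x) (f x) < e" by blast
  qed
  then show ?thesis by blast
qed

text \<open>Two sequences with the same uniform limit differ little on the spectrum, so
  \<open>poly_op_norm_le\<close> makes each of them Cauchy and forces a common limit. The given
  sequence also secures uniqueness in the description of \<open>cfc\<close>, whose condition would
  be vacuous if no sequence converged to f.\<close>

lemma cfc_LIMSEQ:
  assumes A: "self_adjoint A"
    and lim: "uniform_limit (real_spectrum A) (\<lambda>n. poly (p n)) f sequentially"
  shows "(\<lambda>n. poly_op (p n) A) \<longlonglongrightarrow> cfc f A"
proof -
  have close: "\<exists>N. \<forall>m\<ge>N. \<forall>n\<ge>N. norm (poly_op (u m) A - poly_op (v n) A) \<le> e"
    if u: "uniform_limit (real_spectrum A) (\<lambda>n. poly (u n)) f sequentially"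
    and v: "uniform_limit (real_spectrum A) (\<lambda>n. poly (v n)) f sequentially"
    and "0 < e" for u v e
  proof -
    from \<open>0 < e\<close> have "0 < e / 2" by simp
    with u v obtain N1 N2 where
      N1: "\<forall>n\<ge>N1. \<forall>x\<in>real_spectrum A. dist (poly (u n) x) (f x) < e / 2" and
      N2: "\<forall>n\<ge>N2. \<forall>x\<in>real_spectrum A. dist (poly (v n) x) (f x) < e / 2"
      unfolding uniform_limit_sequentially_iff by metis
    have "norm (poly_op (u m) A - poly_op (v n) A) \<le> e" if "m \<ge> max N1 N2" "n \<ge> max N1 N2" for m n
      unfolding poly_op_diff [symmetric]
    proof (rule poly_op_norm_le [OF A])
      fix r assume r: "r \<in> real_spectrum A"
      have "dist (poly (u m) r) (f r) < e / 2" "dist (poly (v n) r) (f r) < e / 2"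
        using N1 N2 that r by auto
      then show "\<bar>poly (u m - v n) r\<bar> \<le> e" unfolding dist_real_def poly_diff by linarith
    qed (use \<open>0 < e\<close> in simp)
    then show ?thesis by blast
  qed
  have "Cauchy (\<lambda>n. poly_op (p n) A)"
    unfolding Cauchy_def
  proof (intro allI impI)
    fix e :: real assume "0 < e"
    then show "\<exists>M. \<forall>m\<ge>M. \<forall>n\<ge>M. dist (poly_op (p m) A) (poly_op (p n) A) < e"
      using close [OF lim lim, of "e / 2"] by (fastforce simp: dist_norm)
  qed
  then obtain T where T: "(\<lambda>n. poly_op (p n) A) \<longlonglongrightarrow> T"
    by (auto simp: Cauchy_convergent_iff convergent_def)
  have all: "(\<lambda>n. poly_op (q n) A) \<longlonglongrightarrow> T"
    if q: "uniform_limit (real_spectrum A) (\<lambda>n. poly (q n)) f sequentially" for q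
  proof -
    have "(\<lambda>n. poly_op (q n) A - poly_op (p n) A) \<longlonglongrightarrow> 0"
      unfolding LIMSEQ_def
    proof (intro allI impI)
      fix e :: real assume "0 < e"
      then show "\<exists>N. \<forall>n\<ge>N. dist (poly_op (q n) A - poly_op (p n) A) 0 < e"
        using close [OF q lim, of "e / 2"] by (fastforce simp: dist_norm)
    qed
    from tendsto_add [OF this T] show ?thesis by simp
  qed
  have "cfc f A = T"
    unfolding cfc_def real_spectrum_def [symmetric]
  proof (rule the_equality)
    fix T' assume "\<forall>q. uniform_limit (real_spectrum A) (\<lambda>n. poly (q n)) f sequentially
      \<longrightarrow> (\<lambda>n. poly_op (q n) A) \<longlonglongrightarrow> T'"
    with lim have "(\<lambda>n. poly_op (p n) A) \<longlonglongrightarrow> T'" by blast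
    then show "T' = T" using T by (rule LIMSEQ_unique)
  qed (use all in blast)
  with T show ?thesis by simp
qed

lemma cfc_approx:
  assumes A: "self_adjoint A" and "continuous_on (real_spectrum A) f"
  obtains p where "uniform_limit (real_spectrum A) (\<lambda>n. poly (p n)) f sequentially"
    "(\<lambda>n. poly_op (p n) A) \<longlonglongrightarrow> cfc f A"
  using uniform_limit_polynomials [OF compact_real_spectrum [OF A] assms(2)] cfc_LIMSEQ [OF A] by blast

lemma cfc_norm_le:
  assumes A: "self_adjoint A" and "continuous_on (real_spectrum A) f" and e: "0 \<le> e"
    and le: "\<And>r. r \<in> real_spectrum A \<Longrightarrow> \<bar>f r\<bar> \<le> e"
  shows "norm (cfc f A) \<le> e"
proof (rule field_le_epsilon)
  fix d :: real assume "0 < d"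
  obtain p where p: "uniform_limit (real_spectrum A) (\<lambda>n. poly (p n)) f sequentially"
    "(\<lambda>n. poly_op (p n) A) \<longlonglongrightarrow> cfc f A" using cfc_approx [OF assms(1,2)] .
  obtain N where N: "\<And>n r. n \<ge> N \<Longrightarrow> r \<in> real_spectrum A \<Longrightarrow> dist (poly (p n) r) (f r) < d"
    using p(1) \<open>0 < d\<close> unfolding uniform_limit_sequentially_iff by metis
  have "norm (poly_op (p n) A) \<le> e + d" if "n \<ge> N" for n
  proof (rule poly_op_norm_le [OF A])
    fix r assume "r \<in> real_spectrum A"
    then show "\<bar>poly (p n) r\<bar> \<le> e + d"
      using N [OF that, of r] le [of r] by (auto simp: dist_real_def)
  qed (use e \<open>0 < d\<close> in simp)
  then show "norm (cfc f A) \<le> e + d"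
    by (intro LIMSEQ_le_const2 [OF tendsto_norm [OF p(2)]]) blast
qed

lemma cfc_cong: "(\<And>r. r \<in> real_spectrum A \<Longrightarrow> f r = g r) \<Longrightarrow> cfc f A = cfc g A"
  using uniform_limit_cong' [of "real_spectrum A" "\<lambda>n. poly (_ n)" "\<lambda>n. poly (_ n)" f g sequentially]
  unfolding cfc_def real_spectrum_def [symmetric] by simp

lemma cfc_poly: "self_adjoint A \<Longrightarrow> cfc (poly p) A = poly_op p A"
  using cfc_LIMSEQ [of A "\<lambda>_. p" "poly p"]
  by (simp add: uniform_limit_const LIMSEQ_const_iff)

lemma cfc_const: "self_adjoint A \<Longrightarrow> cfc (\<lambda>_. c) A = c *\<^sub>R id_blinfun"
  using cfc_poly [of A "[:c:]"] cfc_cong [of A "poly [:c:]" "\<lambda>_. c"] by simp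

lemma cfc_ident: "self_adjoint A \<Longrightarrow> cfc (\<lambda>r. r) A = A"
  using cfc_poly [of A "[:0, 1:]"] cfc_cong [of A "poly [:0, 1:]" "\<lambda>r. r"]
  by (simp add: blinfun_eqI)

lemma self_adjoint_cfc:
  assumes A: "self_adjoint A" and f: "continuous_on (real_spectrum A) f"
  shows "self_adjoint (cfc f A)"
proof -
  obtain p where "(\<lambda>n. poly_op (p n) A) \<longlonglongrightarrow> cfc f A" using cfc_approx [OF assms] .
  then show ?thesis using self_adjoint_poly_op [OF A] by (rule self_adjoint_LIMSEQ [rotated])
qed

lemma cfc_add:
  assumes A: "self_adjoint A"
    and f: "continuous_on (real_spectrum A) f" and g: "continuous_on (real_spectrum A) g"
  shows "cfc (\<lambda>r. f r + g r) A = cfc f A + cfc g A"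
proof -
  obtain p where p: "uniform_limit (real_spectrum A) (\<lambda>n. poly (p n)) f sequentially"
    "(\<lambda>n. poly_op (p n) A) \<longlonglongrightarrow> cfc f A" using cfc_approx [OF A f] .
  obtain q where q: "uniform_limit (real_spectrum A) (\<lambda>n. poly (q n)) g sequentially"
    "(\<lambda>n. poly_op (q n) A) \<longlonglongrightarrow> cfc g A" using cfc_approx [OF A g] .
  have "(\<lambda>n. poly_op (p n + q n) A) \<longlonglongrightarrow> cfc (\<lambda>r. f r + g r) A"
    using uniform_limit_add [OF p(1) q(1)] by (intro cfc_LIMSEQ [OF A]) (simp flip: poly_add)
  moreover have "(\<lambda>n. poly_op (p n + q n) A) \<longlonglongrightarrow> cfc f A + cfc g A"
    unfolding poly_op_add by (intro tendsto_intros p q)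
  ultimately show ?thesis by (rule LIMSEQ_unique)
qed

lemma cfc_mult:
  assumes A: "self_adjoint A"
    and f: "continuous_on (real_spectrum A) f" and g: "continuous_on (real_spectrum A) g"
  shows "cfc (\<lambda>r. f r * g r) A = cfc f A o\<^sub>L cfc g A"
proof -
  obtain p where p: "uniform_limit (real_spectrum A) (\<lambda>n. poly (p n)) f sequentially"
    "(\<lambda>n. poly_op (p n) A) \<longlonglongrightarrow> cfc f A" using cfc_approx [OF A f] .
  obtain q where q: "uniform_limit (real_spectrum A) (\<lambda>n. poly (q n)) g sequentially"
    "(\<lambda>n. poly_op (q n) A) \<longlonglongrightarrow> cfc g A" using cfc_approx [OF A g] .
  have "bounded (f ` real_spectrum A)" "bounded (g ` real_spectrum A)"
    using f g by (auto intro!: compact_imp_bounded compact_continuous_image compact_real_spectrum A)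
  then have "(\<lambda>n. poly_op (p n * q n) A) \<longlonglongrightarrow> cfc (\<lambda>r. f r * g r) A"
    using uniform_lim_mult [OF p(1) q(1)] by (intro cfc_LIMSEQ [OF A]) (simp flip: poly_mult)
  moreover have "(\<lambda>n. poly_op (p n * q n) A) \<longlonglongrightarrow> (cfc f A o\<^sub>L cfc g A)"
    unfolding poly_op_mult
    by (intro bounded_bilinear.tendsto [OF bounded_bilinear_blinfun_compose] p q)
  ultimately show ?thesis by (rule LIMSEQ_unique)
qed

lemma cfc_scaleR:
  assumes "self_adjoint A" "continuous_on (real_spectrum A) f"
  shows "cfc (\<lambda>r. c * f r) A = c *\<^sub>R cfc f A"
  using cfc_mult [OF assms(1) _ assms(2), of "\<lambda>_. c"] assms(1)
  by (simp add: cfc_const blinfun_eqI op_simps)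

lemma cfc_diff:
  assumes "self_adjoint A" "continuous_on (real_spectrum A) f" "continuous_on (real_spectrum A) g"
  shows "cfc (\<lambda>r. f r - g r) A = cfc f A - cfc g A"
  using cfc_add [OF assms(1,2), of "\<lambda>r. (-1) * g r"] cfc_scaleR [OF assms(1,3), of "-1"] assms(3)
  by (simp add: continuous_on_minus)

lemma cfc_nonneg:
  assumes A: "self_adjoint A" and f: "continuous_on (real_spectrum A) f"
    and "\<And>r. r \<in> real_spectrum A \<Longrightarrow> 0 \<le> f r"
  shows "cfc f A \<in> pos_ops"
proof -
  have s: "continuous_on (real_spectrum A) (\<lambda>r. sqrt (f r))" by (intro continuous_intros f)
  have "cfc f A = cfc (\<lambda>r. sqrt (f r) * sqrt (f r)) A" using assms(3) by (intro cfc_cong) simp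
  also have "\<dots> = cfc (\<lambda>r. sqrt (f r)) A o\<^sub>L cfc (\<lambda>r. sqrt (f r)) A" by (rule cfc_mult [OF A s s])
  finally show ?thesis using pos_ops_square [OF self_adjoint_cfc [OF A s]] by simp
qed

lemma cfc_mono:
  assumes A: "self_adjoint A"
    and f: "continuous_on (real_spectrum A) f" and g: "continuous_on (real_spectrum A) g"
    and "\<And>r. r \<in> real_spectrum A \<Longrightarrow> f r \<le> g r"
  shows "cfc f A \<preceq> cfc g A"
  unfolding op_le_def cfc_diff [OF A g f, symmetric]
  using assms by (intro cfc_nonneg continuous_on_diff) auto

text \<open>If c is not a value of f on the spectrum, then 1/(f - c) is continuous there and its
  calculus supplies the inverse of f(A) - c.\<close>

lemma real_spectrum_cfc:
  assumes A: "self_adjoint A" and f: "continuous_on (real_spectrum A) f"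
  shows "real_spectrum (cfc f A) \<subseteq> f ` real_spectrum A"
proof
  fix c assume c: "c \<in> real_spectrum (cfc f A)"
  show "c \<in> f ` real_spectrum A"
  proof (rule ccontr)
    assume "c \<notin> f ` real_spectrum A"
    then have nz: "f r - c \<noteq> 0" if "r \<in> real_spectrum A" for r using that by auto
    have h: "continuous_on (real_spectrum A) (\<lambda>r. f r - c)"
      and g: "continuous_on (real_spectrum A) (\<lambda>r. 1 / (f r - c))"
      using nz by (auto intro!: continuous_intros f)
    have fc: "cfc (\<lambda>r. f r - c) A = cfc f A - scalar_op (complex_of_real c)"
      using cfc_diff [OF A f, of "\<lambda>_. c"] A by (simp add: cfc_const scalar_op_of_real)
    have "cfc (\<lambda>r. 1 / (f r - c) * (f r - c)) A = id_blinfun"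
      "cfc (\<lambda>r. (f r - c) * (1 / (f r - c))) A = id_blinfun"
      using cfc_cong [of A _ "\<lambda>_. 1"] nz cfc_const [OF A, of 1] by simp_all
    then have "invertible_op (cfc f A - scalar_op (complex_of_real c))"
      unfolding cfc_mult [OF A g h] cfc_mult [OF A h g] fc invertible_op_def
      using self_adjoint_bounded_ops [OF self_adjoint_cfc [OF A g]] by blast
    with c show False by (simp add: real_spectrum_def spectrum_def)
  qed
qed

lemma cfc_compose_poly:
  assumes A: "self_adjoint A" and f: "continuous_on (real_spectrum A) f"
  shows "cfc (\<lambda>r. poly p (f r)) A = poly_op p (cfc f A)"
proof (induction p)
  case (pCons c p)
  have "continuous_on (real_spectrum A) (\<lambda>r. poly p (f r))"
    by (intro continuous_intros f)
  then show ?case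
    using cfc_add [OF A continuous_on_const, of "\<lambda>r. f r * poly p (f r)" c] cfc_mult [OF A f] pCons
    by (simp add: cfc_const [OF A] continuous_on_mult f)
qed (simp add: cfc_const [OF A])

text \<open>Polynomials approximating g on the image of the spectrum under f serve both sides: the
  spectrum of f(A) lies in that image, and composed with f they converge uniformly on the spectrum
  of A.\<close>

lemma cfc_compose:
  assumes A: "self_adjoint A" and f: "continuous_on (real_spectrum A) f"
    and g: "continuous_on (f ` real_spectrum A) g"
  shows "cfc g (cfc f A) = cfc (\<lambda>r. g (f r)) A"
proof -
  obtain p :: "nat \<Rightarrow> real poly"
    where p: "uniform_limit (f ` real_spectrum A) (\<lambda>n. poly (p n)) g sequentially"
    using uniform_limit_polynomials [OF compact_continuous_image [OF f compact_real_spectrum [OF A]] g]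
    by blast
  have 1: "(\<lambda>n. poly_op (p n) (cfc f A)) \<longlonglongrightarrow> cfc g (cfc f A)"
    using uniform_limit_on_subset [OF p real_spectrum_cfc [OF A f]]
    by (rule cfc_LIMSEQ [OF self_adjoint_cfc [OF A f]])
  have "(\<lambda>n. cfc (\<lambda>r. poly (p n) (f r)) A) \<longlonglongrightarrow> cfc (\<lambda>r. g (f r)) A"
    unfolding LIMSEQ_def
  proof (intro allI impI)
    fix e :: real assume "0 < e"
    then obtain N where N: "\<And>n r. n \<ge> N \<Longrightarrow> r \<in> real_spectrum A \<Longrightarrow> dist (poly (p n) (f r)) (g (f r)) < e / 2"
      using p unfolding uniform_limit_sequentially_iff by (metis half_gt_zero imageI)
    have "dist (cfc (\<lambda>r. poly (p n) (f r)) A) (cfc (\<lambda>r. g (f r)) A) < e" if "n \<ge> N" for n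
    proof -
      have c: "continuous_on (real_spectrum A) (\<lambda>r. poly (p n) (f r))"
        "continuous_on (real_spectrum A) (\<lambda>r. g (f r))"
        by (intro continuous_intros f) (rule continuous_on_compose2 [OF g f], simp)
      have "norm (cfc (\<lambda>r. poly (p n) (f r) - g (f r)) A) \<le> e / 2"
        using N [OF that] \<open>0 < e\<close>
        by (intro cfc_norm_le A continuous_on_diff c) (auto simp: dist_real_def intro: less_imp_le)
      with \<open>0 < e\<close> show ?thesis by (simp add: cfc_diff [OF A c] dist_norm)
    qed
    then show "\<exists>N. \<forall>n\<ge>N. dist (cfc (\<lambda>r. poly (p n) (f r)) A) (cfc (\<lambda>r. g (f r)) A) < e" by blast
  qed
  with 1 show ?thesis unfolding cfc_compose_poly [OF A f] by (rule LIMSEQ_unique)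
qed

section \<open>Operator monotone functions\<close>

lemma cinner_scaleR_left: "cinner (r *\<^sub>R x) y = complex_of_real r * cinner (x::'h::complex_hilbert_space) y"
  by (metis cinner_scaleC_left scaleC_of_real)

lemma cinner_scaleR_right: "cinner x (r *\<^sub>R y) = complex_of_real r * cinner (x::'h::complex_hilbert_space) y"
  by (metis cinner_scaleC_right complex_cnj_complex_of_real scaleC_of_real)

lemma cinner_diff_right: "cinner x (y - z) = cinner x y - cinner (x::'h::complex_hilbert_space) z"
  using cinner_add_right [of x y "(-1) *\<^sub>R z"] cinner_scaleR_right [of x "-1" z] by simp

lemma cinner_diff_left: "cinner (x - y) z = cinner x z - cinner (y::'h::complex_hilbert_space) z"
  using cinner_add_left [of x "(-1) *\<^sub>R y" z] cinner_scaleR_left [of "-1" y z] by simp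

text \<open>A phase of modulus 1 rotates the complex inner product into a nonnegative real, where
  the real inequality applies.\<close>

lemma complex_Cauchy_Schwarz:
  fixes x y :: "'h::complex_hilbert_space"
  shows "cmod (cinner x y) \<le> norm x * norm y"
proof (cases "cinner x y = 0")
  case False
  define z c where "z = cinner x y" and "c = cnj z / cmod z"
  have z: "z \<noteq> 0" using False by (simp add: z_def)
  then have c: "cmod c = 1" by (simp add: c_def norm_divide)
  have "c * z = cmod z"
    using z by (simp add: c_def complex_norm_square [symmetric] power2_eq_square mult.commute [of "cnj z"])
  then have "cmod z = Re (cinner (c *\<^sub>C x) y)" by (simp add: cinner_scaleC_left z_def)
  also have "\<dots> \<le> norm (c *\<^sub>C x) * norm y" unfolding Re_cinner by (rule norm_cauchy_schwarz)
  finally show ?thesis by (simp add: norm_scaleC c z_def)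
qed simp

text \<open>For a unit vector \<open>u\<close> this is the orthogonal projection onto the complex
  line through \<open>u\<close>.\<close>

lift_definition rank_one :: "'h::complex_hilbert_space \<Rightarrow> 'h op"
  is "\<lambda>u x. cinner x u *\<^sub>C u"
proof (rule bounded_linear_intro)
  fix u x y :: 'h and r :: real
  show "cinner (x + y) u *\<^sub>C u = cinner x u *\<^sub>C u + cinner y u *\<^sub>C u"
    by (simp add: cinner_add_left scaleC_add_left)
  show "cinner (r *\<^sub>R x) u *\<^sub>C u = r *\<^sub>R cinner x u *\<^sub>C u"
    by (simp add: cinner_scaleR_left scaleC_of_real flip: scaleC_scaleC)
  show "norm (cinner x u *\<^sub>C u) \<le> norm x * (norm u * norm u)"
    using mult_right_mono [OF complex_Cauchy_Schwarz [of x u], of "norm u"]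
    by (simp add: norm_scaleC mult.assoc)
qed

lemma self_adjoint_rank_one: "self_adjoint (rank_one u)"
proof (intro self_adjointI bounded_opsI)
  show "rank_one u (c *\<^sub>C x) = c *\<^sub>C rank_one u x" for c x
    by (simp add: rank_one.rep_eq cinner_scaleC_left scaleC_scaleC)
  show "inner (rank_one u x) y = inner x (rank_one u y)" for x y
    unfolding Re_cinner [symmetric] rank_one.rep_eq cinner_scaleC_left cinner_scaleC_right
    by (subst cinner_commute [of y u]) (simp add: mult.commute)
qed

lemma rank_one_idem: "cinner u u = 1 \<Longrightarrow> rank_one u o\<^sub>L rank_one u = rank_one u"
  by (rule blinfun_eqI) (simp add: rank_one.rep_eq cinner_scaleC_left)

lemma inner_rank_one: "inner (rank_one u x) x = (cmod (cinner x u))\<^sup>2"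
proof -
  have "cinner x u * cinner u x = complex_of_real ((cmod (cinner x u))\<^sup>2)"
    by (subst cinner_commute [of u x]) (simp add: complex_norm_square del: of_real_power)
  then have "Re (cinner x u * cinner u x) = (cmod (cinner x u))\<^sup>2" by simp
  then show ?thesis by (simp add: Re_cinner [symmetric] rank_one.rep_eq cinner_scaleC_left)
qed

lemma norm_rank_one_diff:
  assumes "norm u = 1" "norm e = 1"
  shows "norm (rank_one u - rank_one e) \<le> 2 * norm (u - e)"
proof (rule norm_blinfun_bound)
  fix x
  have "(rank_one u - rank_one e) x = cinner x (u - e) *\<^sub>C u + cinner x e *\<^sub>C (u - e)"
    by (simp add: op_simps rank_one.rep_eq cinner_diff_right scaleC_diff_right
      flip: scaleC_add_left)
  also have "norm \<dots> \<le> cmod (cinner x (u - e)) + cmod (cinner x e) * norm (u - e)"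
    by (rule norm_triangle_le) (simp add: norm_scaleC assms)
  also have "\<dots> \<le> norm x * norm (u - e) + (norm x * norm e) * norm (u - e)"
    by (intro add_mono mult_right_mono complex_Cauchy_Schwarz) simp
  finally show "norm ((rank_one u - rank_one e) x) \<le> 2 * norm (u - e) * norm x"
    by (simp add: assms algebra_simps)
qed simp

text \<open>The spectrum is contained in {a, a + s}, and on two points f agrees with an affine
  function, so the calculus reduces to a polynomial of degree at most one.\<close>

lemma cfc_affine_projection:
  assumes Q: "self_adjoint Q" "Q o\<^sub>L Q = Q"
  shows "cfc f (a *\<^sub>R id_blinfun + s *\<^sub>R Q) = f a *\<^sub>R id_blinfun + (f (a + s) - f a) *\<^sub>R Q"
proof -
  define A where "A = a *\<^sub>R id_blinfun + s *\<^sub>R Q"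
  have A: "self_adjoint A"
    unfolding A_def by (intro self_adjoint_add self_adjoint_scaleR self_adjoint_id Q)
  have sp: "r = a \<or> r = a + s" if "r \<in> real_spectrum A" for r
  proof (rule ccontr)
    assume r: "\<not> (r = a \<or> r = a + s)"
    define \<alpha> where "\<alpha> = a - r"
    have \<alpha>: "\<alpha> \<noteq> 0" "\<alpha> + s \<noteq> 0" using r by (auto simp: \<alpha>_def)
    define K where "K = 1 + \<bar>s / (\<alpha> + s)\<bar> * norm Q"
    have K: "0 < K" unfolding K_def by (intro add_pos_nonneg) auto
    have "bounded_below (\<lambda>x. A x - r *\<^sub>R x)"
    proof (rule bounded_belowI)
      show "0 < \<bar>\<alpha>\<bar> / K" using \<alpha> K by simp
      fix x
      define y where "y = A x - r *\<^sub>R x"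
      have y: "y = \<alpha> *\<^sub>R x + s *\<^sub>R Q x"
        by (simp add: y_def A_def op_simps \<alpha>_def scaleR_diff_left)
      have "Q (Q x) = Q x" using Q(2) by (metis blinfun_apply_blinfun_compose)
      \<comment> \<open>Applying Q isolates Q x, after which x is recovered from y. This explicit
        resolvent yields the lower bound |\<alpha>|/K.\<close>
      then have "Q y = (\<alpha> + s) *\<^sub>R Q x" by (simp add: y op_simps scaleR_add_left)
      then have "\<alpha> *\<^sub>R x = y - (s / (\<alpha> + s)) *\<^sub>R Q y" using \<alpha> by (simp add: y)
      then have "\<bar>\<alpha>\<bar> * norm x = norm (y - (s / (\<alpha> + s)) *\<^sub>R Q y)" by (metis norm_scaleR)
      also have "\<dots> \<le> norm y + \<bar>s / (\<alpha> + s)\<bar> * norm (Q y)"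
        using norm_triangle_ineq4 [of y "(s / (\<alpha> + s)) *\<^sub>R Q y"] by (simp only: norm_scaleR)
      also have "\<dots> \<le> norm y + \<bar>s / (\<alpha> + s)\<bar> * (norm Q * norm y)"
        by (intro add_left_mono mult_left_mono norm_blinfun) simp
      also have "\<dots> = K * norm y" unfolding K_def distrib_right mult.assoc by simp
      finally show "\<bar>\<alpha>\<bar> / K * norm x \<le> norm (A x - r *\<^sub>R x)"
        using K by (simp add: pos_divide_le_eq mult.commute y_def)
    qed
    with that show False by (simp add: real_spectrum_iff [OF A])
  qed
  define k where "k = (f (a + s) - f a) / s"
  \<comment> \<open>For s = 0 the division gives k = 0, and both sides vanish.\<close>
  have ks: "k * s = f (a + s) - f a" by (cases "s = 0") (simp_all add: k_def)
  have "cfc f A = cfc (poly [:f a - a * k, k:]) A"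
  proof (rule cfc_cong)
    fix r assume "r \<in> real_spectrum A"
    then show "f r = poly [:f a - a * k, k:] r"
      using sp [of r] ks by (auto simp: algebra_simps)
  qed
  also have "\<dots> = (f a - a * k) *\<^sub>R id_blinfun + k *\<^sub>R A"
    unfolding cfc_poly [OF A] by (rule blinfun_eqI) (simp add: op_simps)
  also have "\<dots> = f a *\<^sub>R id_blinfun + (k * s) *\<^sub>R Q"
    by (rule blinfun_eqI) (simp add: A_def op_simps scaleR_diff_left scaleR_add_right mult.commute)
  finally show ?thesis unfolding ks A_def .
qed

text \<open>For a projection Q the form equals a (|x|^2 - |Q x|^2) + (a + s) |Q x|^2, and both
  brackets are nonnegative.\<close>

lemma pos_ops_affine_projection:
  assumes Q: "self_adjoint Q" "Q o\<^sub>L Q = Q" and "0 \<le> a" "0 \<le> a + s"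
  shows "a *\<^sub>R id_blinfun + s *\<^sub>R Q \<in> pos_ops"
proof (rule pos_opsI)
  fix x
  have QQ: "Q (Q x) = Q x" using Q(2) by (metis blinfun_apply_blinfun_compose)
  then have nQ: "inner (Q x) x = (norm (Q x))\<^sup>2"
    using self_adjointD [OF Q(1), of "Q x" x] by (simp add: power2_norm_eq_inner)
  have "0 \<le> (norm (x - 1 *\<^sub>R Q x))\<^sup>2" by simp
  then have D: "0 \<le> (norm x)\<^sup>2 - (norm (Q x))\<^sup>2"
    unfolding norm_sq_diff_scaleR nQ by simp
  have "0 \<le> a * ((norm x)\<^sup>2 - (norm (Q x))\<^sup>2) + (a + s) * (norm (Q x))\<^sup>2"
    using mult_nonneg_nonneg [OF assms(3) D] mult_nonneg_nonneg [OF assms(4), of "(norm (Q x))\<^sup>2"]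
    by simp
  then show "0 \<le> inner ((a *\<^sub>R id_blinfun + s *\<^sub>R Q) x) x"
    using nQ by (simp add: op_simps inner_add_left dot_square_norm algebra_simps)
qed (intro self_adjoint_add self_adjoint_scaleR self_adjoint_id Q)

lemma cinner_self: "cinner x x = complex_of_real ((norm (x::'h::complex_hilbert_space))\<^sup>2)"
proof -
  have "Im (cinner x x) = 0" using arg_cong [OF cinner_commute [of x x], of Im] by simp
  then show ?thesis by (simp add: complex_eq_iff Re_cinner power2_norm_eq_inner)
qed

lemma norm_eq_1_cinner:
  assumes "cinner x x = 1"
  shows "norm x = 1"
proof -
  have "(norm x)\<^sup>2 = 1" using assms unfolding cinner_self of_real_eq_1_iff .
  then have "sqrt ((norm x)\<^sup>2) = 1" by simp
  then show ?thesis by simp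
qed

lemma ell2_orthonormal_pair:
  obtains e d :: ell2 where "cinner e e = 1" "cinner d d = 1" "cinner e d = 0" "cinner d e = 0"
proof -
  define v where "v k = Abs_ell2 (\<lambda>n. if n = k then 1 else 0)" for k :: nat
  have v: "coord (v k) = (\<lambda>n. if n = k then 1 else 0)" for k
  proof -
    have "summable (\<lambda>n. (cmod (if n = k then 1 else 0))\<^sup>2)"
      by (rule summable_finite [of "{k}"]) auto
    then show ?thesis by (simp add: v_def Abs_ell2_inverse)
  qed
  have "cinner (v j) (v k) = (if j = k then 1 else 0)" for j k
  proof -
    have "cinner (v j) (v k) = (\<Sum>n. coord (v j) n * cnj (coord (v k) n))"
      by (simp add: cinner_ell2_def cinner_sum_def)
    also have "\<dots> = (\<Sum>n\<in>{k}. coord (v j) n * cnj (coord (v k) n))"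
      by (rule suminf_finite) (auto simp: v)
    finally show ?thesis by (auto simp: v)
  qed
  then show thesis by (intro that [of "v 0" "v 1"]) auto
qed

section \<open>What operator monotonicity says about scalar values\<close>

lemma operator_monotoneD:
  fixes A B :: "ell2 op"
  assumes "operator_monotone f" "A \<in> pos_ops" "B \<in> pos_ops" "A \<preceq> B"
  shows "cfc f A \<preceq> cfc f B"
  using assms unfolding operator_monotone_def by blast

text \<open>Scalar operators are the case Q = 0 of the two-point formula; their values are compared
  on a unit vector of \<open>ell2\<close>.\<close>

lemma operator_monotone_mono:
  assumes f: "operator_monotone f" and "0 \<le> x" "x \<le> y"
  shows "f x \<le> f y"
proof -
  obtain e d :: ell2 where e: "cinner e e = 1" by (rule ell2_orthonormal_pair)
  have s: "cfc f (r *\<^sub>R id_blinfun :: ell2 op) = f r *\<^sub>R id_blinfun" for r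
    using cfc_affine_projection [OF self_adjoint_zero, of f r 0] by simp
  have "x *\<^sub>R id_blinfun \<in> pos_ops" "y *\<^sub>R id_blinfun \<in> (pos_ops :: ell2 op set)"
    using assms by (auto intro!: pos_ops_scaleR pos_ops_id)
  moreover have "x *\<^sub>R id_blinfun \<preceq> (y *\<^sub>R id_blinfun :: ell2 op)"
    using assms pos_ops_scaleR [OF _ pos_ops_id, of "y - x"] by (simp add: op_le_def scaleR_diff_left)
  ultimately have "cfc f (x *\<^sub>R id_blinfun) \<preceq> cfc f (y *\<^sub>R id_blinfun :: ell2 op)"
    by (rule operator_monotoneD [OF f])
  then have "inner ((f x *\<^sub>R id_blinfun :: ell2 op) e) e \<le> inner ((f y *\<^sub>R id_blinfun :: ell2 op) e) e"
    unfolding s by (subst (asm) op_le_iff) (auto intro: self_adjoint_scaleR self_adjoint_id)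
  moreover have "inner e e = 1" using e by (simp add: Re_cinner [symmetric])
  ultimately show ?thesis by (simp add: op_simps)
qed

text \<open>Let \<open>Q\<^sub>e\<close>, \<open>Q\<^sub>u\<close> be the projections onto two different but nearby lines. Then
  \<open>A = l + (t - l) Q\<^sub>e \<le> l' + (t - l) Q\<^sub>u = B\<close>, whereas
  \<open>f(B) - f(A) = (f (t + l' - l) - f l) Q\<^sub>u - (f t - f l) Q\<^sub>e\<close>; testing this on vectors
  orthogonal to one of the lines determines the sign of both coefficients.\<close>

lemma operator_monotone_plateau:
  assumes f: "operator_monotone f" and l: "0 \<le> l" "l < l'" "f l = f l'" and t: "0 \<le> t"
  shows "f t \<le> f l" "f l \<le> f (t + (l' - l))"
proof -
  obtain e d :: ell2 where ed: "cinner e e = 1" "cinner d d = 1" "cinner e d = 0" "cinner d e = 0"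
    by (rule ell2_orthonormal_pair)
  \<comment> \<open>The tilt is so small that the difference of the projections times t - l, of norm
    at most 2 |t - l| \<eta>, is absorbed by the gap l' - l. The 1 covers t = l.\<close>
  define \<eta> where "\<eta> = (l' - l) / (2 * \<bar>t - l\<bar> + 1)"
  have "0 < 2 * \<bar>t - l\<bar> + 1" by (simp add: add_nonneg_pos)
  then have nz: "2 * \<bar>t - l\<bar> + 1 \<noteq> 0" by simp
  have \<eta>: "0 < \<eta>" using l by (simp add: \<eta>_def add_nonneg_pos)
  have "isCont (\<lambda>\<theta>. norm (cos \<theta> *\<^sub>R e + sin \<theta> *\<^sub>R d - e)) 0" by (intro continuous_intros)
  then obtain s where s: "0 < s"
    "\<And>\<theta>. \<bar>\<theta>\<bar> < s \<Longrightarrow> norm (cos \<theta> *\<^sub>R e + sin \<theta> *\<^sub>R d - e) < \<eta>"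
    using \<eta> by (auto simp: continuous_at_eps_delta dist_real_def)
  \<comment> \<open>Below s the tilt stays under \<eta>; strictly between 0 and pi the sine is
    positive, so the two lines differ.\<close>
  define \<theta> where "\<theta> = min (s / 2) 1"
  have \<theta>: "0 < \<theta>" "\<theta> < s" "\<theta> < pi" using s(1) pi_gt3 by (auto simp: \<theta>_def)
  define u where "u = cos \<theta> *\<^sub>R e + sin \<theta> *\<^sub>R d"
  have sin: "0 < sin \<theta>" using \<theta> by (intro sin_gt_zero)
  have ue: "norm (u - e) < \<eta>" using s(2) [of \<theta>] \<theta> by (simp add: u_def)
  have uu: "cinner u u = 1"
  proof -
    have "cinner u u = complex_of_real (cos \<theta>) * cos \<theta> + complex_of_real (sin \<theta>) * sin \<theta>"
      using ed by (simp add: u_def cinner_add_left cinner_add_right cinner_scaleR_left cinner_scaleR_right)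
    also have "\<dots> = complex_of_real (cos \<theta> * cos \<theta> + sin \<theta> * sin \<theta>)"
      by (simp only: of_real_add of_real_mult)
    finally show ?thesis unfolding sin_cos_squared_add3 by simp
  qed
  note n = norm_eq_1_cinner [OF uu] norm_eq_1_cinner [OF ed(1)]
  define A where "A = l *\<^sub>R id_blinfun + (t - l) *\<^sub>R rank_one e"
  define B where "B = l' *\<^sub>R id_blinfun + (t - l) *\<^sub>R rank_one u"
  note e = self_adjoint_rank_one rank_one_idem [OF ed(1)]
  note u = self_adjoint_rank_one rank_one_idem [OF uu]
  have A: "A \<in> pos_ops" unfolding A_def by (rule pos_ops_affine_projection [OF e]) (use l t in auto)
  have B: "B \<in> pos_ops" unfolding B_def by (rule pos_ops_affine_projection [OF u]) (use l t in auto)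
  have "A \<preceq> B"
    unfolding op_le_def
  proof (rule pos_opsI)
    show "self_adjoint (B - A)" by (intro self_adjoint_diff pos_ops_self_adjoint A B)
    fix x
    have "\<bar>inner ((rank_one u - rank_one e) x) x\<bar> \<le> norm ((rank_one u - rank_one e) x) * norm x"
      by (rule Cauchy_Schwarz_ineq2)
    also have "\<dots> \<le> (2 * norm (u - e) * norm x) * norm x"
      by (intro mult_right_mono order_trans [OF norm_blinfun] norm_rank_one_diff n) auto
    also have "\<dots> \<le> (2 * \<eta> * norm x) * norm x"
      using ue by (intro mult_right_mono) auto
    finally have "\<bar>(t - l) * inner ((rank_one u - rank_one e) x) x\<bar> \<le> \<bar>t - l\<bar> * (2 * \<eta> * (norm x)\<^sup>2)"
      unfolding abs_mult by (intro mult_left_mono) (auto simp: power2_eq_square mult.assoc)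
    also have "\<dots> = (2 * \<bar>t - l\<bar> * \<eta>) * (norm x)\<^sup>2" by simp
    also have "\<dots> \<le> (l' - l) * (norm x)\<^sup>2"
    proof (rule mult_right_mono)
      have "(2 * \<bar>t - l\<bar>) * \<eta> \<le> (2 * \<bar>t - l\<bar> + 1) * \<eta>" using \<eta> by (intro mult_right_mono) auto
      also have "\<dots> = l' - l" using nz by (simp add: \<eta>_def)
      finally show "2 * \<bar>t - l\<bar> * \<eta> \<le> l' - l" .
    qed simp
    finally have "0 \<le> (l' - l) * (norm x)\<^sup>2 + (t - l) * inner ((rank_one u - rank_one e) x) x" by linarith
    also have "\<dots> = inner ((B - A) x) x"
      by (simp add: A_def B_def op_simps inner_add_left inner_diff_left dot_square_norm
        left_diff_distrib right_diff_distrib)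
    finally show "0 \<le> inner ((B - A) x) x" .
  qed
  with A B have le: "cfc f A \<preceq> cfc f B" by (rule operator_monotoneD [OF f])
  have fA: "cfc f A = f l *\<^sub>R id_blinfun + (f t - f l) *\<^sub>R rank_one e"
    using cfc_affine_projection [OF e, of f l "t - l"] by (simp add: A_def)
  \<comment> \<open>Because f l' = f l, the identity parts of f(A) and f(B) coincide and only the
    rank-one parts remain to be compared.\<close>
  have "l' + (t - l) = t + (l' - l)" by simp
  then have fB: "cfc f B = f l *\<^sub>R id_blinfun + (f (t + (l' - l)) - f l) *\<^sub>R rank_one u"
    using cfc_affine_projection [OF u, of f l' "t - l"] l(3) by (simp only: B_def)
  have form: "(f t - f l) * (cmod (cinner x e))\<^sup>2
      \<le> (f (t + (l' - l)) - f l) * (cmod (cinner x u))\<^sup>2" for x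
  proof -
    have "inner (cfc f A x) x \<le> inner (cfc f B x) x"
      using le pos_ops_nonneg [of "cfc f B - cfc f A" x]
      by (simp add: op_le_def op_simps inner_diff_left)
    then show ?thesis by (simp add: fA fB op_simps inner_add_left inner_rank_one)
  qed
  \<comment> \<open>This vector is orthogonal to \<open>u\<close> and removes the right-hand side of
    \<open>form\<close>; \<open>d\<close>, used afterwards, is orthogonal to \<open>e\<close> and
    removes the left-hand side.\<close>
  have "cinner (sin \<theta> *\<^sub>R e - cos \<theta> *\<^sub>R d) u = 0" "cinner (sin \<theta> *\<^sub>R e - cos \<theta> *\<^sub>R d) e = sin \<theta>"
    using ed by (simp_all add: u_def cinner_add_right cinner_diff_left cinner_scaleR_left cinner_scaleR_right)
  with form [of "sin \<theta> *\<^sub>R e - cos \<theta> *\<^sub>R d"] sin show "f t \<le> f l"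
    by (simp add: mult_le_0_iff)
  have "cinner d u = sin \<theta>"
    using ed by (simp add: u_def cinner_add_right cinner_scaleR_right)
  with form [of d] ed sin show "f l \<le> f (t + (l' - l))"
    by (simp add: zero_le_mult_iff)
qed

text \<open>A plateau bounds all values by f l from above, and from below those at arguments at
  least its width. By monotonicity a plateau contains arbitrarily short ones, so f equals f l at
  every positive t; continuity adds t = 0.\<close>

lemma operator_monotone_inj_or_const:
  assumes f: "operator_monotone f" and "\<not> inj_on f {0..}" and t: "0 \<le> t"
  shows "f t = f 0"
proof -
  obtain l l' where l: "0 \<le> l" "l < l'" "f l = f l'"
    using assms(2) unfolding inj_on_def by (metis atLeast_iff linorder_neqE_linordered_idom)
  have pos: "f t = f l" if "0 < t" for t
  proof (rule antisym)
    show "f t \<le> f l" using operator_monotone_plateau(1) [OF f l] that by simp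
    \<comment> \<open>The shortened plateau has width at most t, so t - \<delta> is a legal
      argument, and it stays inside [l, l'].\<close>
    define \<delta> where "\<delta> = min (l' - l) t"
    have \<delta>: "0 < \<delta>" "\<delta> \<le> t" "l + \<delta> \<le> l'" using l that by (auto simp: \<delta>_def)
    have "f l \<le> f (l + \<delta>)" "f (l + \<delta>) \<le> f l'" using l \<delta>
      by (intro operator_monotone_mono [OF f]; simp)+
    with l have "f l = f (l + \<delta>)" by simp
    from operator_monotone_plateau(2) [OF f l(1) _ this, of "t - \<delta>"] \<delta> show "f l \<le> f t" by simp
  qed
  have "(\<lambda>n. f (inverse (real (Suc n)))) \<longlonglongrightarrow> f 0"
    using f by (intro continuous_on_tendsto_compose [of "{0..}" f] LIMSEQ_inverse_real_of_nat)
      (auto simp: operator_monotone_def)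
  then have "f 0 = f l" by (simp add: pos LIMSEQ_const_iff)
  then show ?thesis using pos t by (cases "t = 0") auto
qed

section \<open>Connections\<close>

lemma op_le_refl: "T \<preceq> T"
  by (simp add: op_le_def pos_ops_iff self_adjoint_zero)

lemma op_le_trans [trans]: "S \<preceq> T \<Longrightarrow> T \<preceq> U \<Longrightarrow> S \<preceq> U"
  using pos_ops_add [of "T - S" "U - T"] by (simp add: op_le_def)

lemma op_le_form: "S \<preceq> T \<Longrightarrow> inner (S x) x \<le> inner (T x) x"
  using pos_ops_nonneg [of "T - S" x] by (simp add: op_le_def op_simps inner_diff_left)

lemma cfc_sandwich:
  assumes A: "self_adjoint A"
    and g: "continuous_on (real_spectrum A) g" and u: "continuous_on (real_spectrum A) u"
  shows "cfc g A o\<^sub>L cfc u A o\<^sub>L cfc g A = cfc (\<lambda>r. g r * u r * g r) A"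
  using assms by (simp add: cfc_mult continuous_on_mult)

lemma cfc_sandwich_const:
  assumes A: "self_adjoint A" and g: "continuous_on (real_spectrum A) g"
  shows "cfc g A o\<^sub>L (c *\<^sub>R id_blinfun) o\<^sub>L cfc g A = cfc (\<lambda>r. g r * c * g r) A"
  using cfc_sandwich [OF A g, of "\<lambda>_. c"] by (simp add: cfc_const [OF A])

lemma cfc_sandwich_ident:
  assumes A: "self_adjoint A" and g: "continuous_on (real_spectrum A) g"
  shows "cfc g A o\<^sub>L A o\<^sub>L cfc g A = cfc (\<lambda>r. g r * r * g r) A"
  using cfc_sandwich [OF A g, of "\<lambda>r. r"] by (simp add: cfc_ident [OF A])

lemma cfc_sum:
  assumes A: "self_adjoint A" and "\<And>i. i \<in> I \<Longrightarrow> continuous_on (real_spectrum A) (g i)"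
  shows "cfc (\<lambda>r. \<Sum>i\<in>I. g i r) A = (\<Sum>i\<in>I. cfc (g i) A)"
  using assms(2)
proof (induction I rule: infinite_finite_induct)
  case (insert i I)
  then show ?case
    using cfc_add [OF A, of "g i" "\<lambda>r. \<Sum>i\<in>I. g i r"] by (simp add: continuous_on_sum)
qed (simp_all add: cfc_const [OF A])

lemma cfc_apply_mult:
  assumes "self_adjoint A" "continuous_on (real_spectrum A) g" "continuous_on (real_spectrum A) h"
  shows "cfc g A (cfc h A x) = cfc (\<lambda>r. g r * h r) A x"
  by (simp add: cfc_mult assms)

lemma norm_cfc_sq:
  assumes A: "self_adjoint A" and h: "continuous_on (real_spectrum A) h"
  shows "(norm (cfc h A x))\<^sup>2 = inner (cfc (\<lambda>r. h r * h r) A x) x"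
  using self_adjointD [OF self_adjoint_cfc [OF A h], of "cfc h A x" x]
  by (simp add: power2_norm_eq_inner cfc_mult assms)

text \<open>Each entry is charged to both of its indices, a factor 2, and each index has at most
  three partners, itself included, a factor 3. The constant is independent of n.\<close>

lemma tridiagonal_sum_bound:
  fixes b :: "nat \<Rightarrow> real" and M :: "nat \<Rightarrow> nat \<Rightarrow> real"
  assumes b: "\<And>i. 0 \<le> b i" and c: "0 \<le> c"
    and near: "\<And>i j. i \<le> n \<Longrightarrow> j \<le> n \<Longrightarrow> i \<le> Suc j \<Longrightarrow> j \<le> Suc i \<Longrightarrow> \<bar>M i j\<bar> \<le> c * (b i + b j)"
    and far: "\<And>i j. i \<le> n \<Longrightarrow> j \<le> n \<Longrightarrow> \<not> (i \<le> Suc j \<and> j \<le> Suc i) \<Longrightarrow> M i j = 0"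
  shows "\<bar>\<Sum>i\<le>n. \<Sum>j\<le>n. M i j\<bar> \<le> 6 * c * (\<Sum>i\<le>n. b i)"
proof -
  define m where "m i j = (if i \<le> Suc j \<and> j \<le> Suc i then c * b i else 0)" for i j
  have "\<bar>\<Sum>i\<le>n. \<Sum>j\<le>n. M i j\<bar> \<le> (\<Sum>i\<le>n. \<Sum>j\<le>n. \<bar>M i j\<bar>)"
    by (rule order_trans [OF sum_abs sum_mono]) (rule sum_abs)
  also have "\<dots> \<le> (\<Sum>i\<le>n. \<Sum>j\<le>n. m i j + m j i)"
  proof (intro sum_mono)
    fix i j assume "i \<in> {..n}" "j \<in> {..n}"
    then show "\<bar>M i j\<bar> \<le> m i j + m j i"
      using near [of i j] far [of i j] by (auto simp: m_def algebra_simps)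
  qed
  also have "\<dots> = (\<Sum>i\<le>n. \<Sum>j\<le>n. m i j) + (\<Sum>i\<le>n. \<Sum>j\<le>n. m j i)"
    by (simp add: sum.distrib)
  also have "(\<Sum>i\<le>n. \<Sum>j\<le>n. m j i) = (\<Sum>i\<le>n. \<Sum>j\<le>n. m i j)"
    by (rule sum.swap)
  also have "(\<Sum>i\<le>n. \<Sum>j\<le>n. m i j) \<le> (\<Sum>i\<le>n. 3 * c * b i)"
  proof (rule sum_mono)
    fix i
    \<comment> \<open>At i = 0 the truncated difference i - 1 is 0, and the interval has just two
      elements.\<close>
    have "{j \<in> {..n}. i \<le> Suc j \<and> j \<le> Suc i} \<subseteq> {i - 1..Suc i}" by auto
    then have "card {j \<in> {..n}. i \<le> Suc j \<and> j \<le> Suc i} \<le> card {i - 1..Suc i}"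
      by (rule card_mono [rotated]) simp
    also have "\<dots> \<le> 3" by simp
    finally have "real (card {j \<in> {..n}. i \<le> Suc j \<and> j \<le> Suc i}) * (c * b i) \<le> 3 * (c * b i)"
      using b c by (intro mult_right_mono) auto
    then show "(\<Sum>j\<le>n. m i j) \<le> 3 * c * b i"
      unfolding m_def by (subst sum.inter_filter [symmetric]) auto
  qed
  finally show ?thesis by (simp add: sum_distrib_left mult.assoc)
qed

section \<open>A connection with its representing function\<close>

locale represented_connection =
  fixes \<sigma> :: "'h::complex_hilbert_space op \<Rightarrow> 'h op \<Rightarrow> 'h op" and f :: "real \<Rightarrow> real"
  assumes connection: "connection \<sigma>" and representing: "representing_function \<sigma> f"
begin

lemma conn_pos: "A \<in> pos_ops \<Longrightarrow> B \<in> pos_ops \<Longrightarrow> \<sigma> A B \<in> pos_ops"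
  using connection unfolding connection_def by blast

lemma conn_mono:
  "A \<in> pos_ops \<Longrightarrow> B \<in> pos_ops \<Longrightarrow> C \<in> pos_ops \<Longrightarrow> D \<in> pos_ops \<Longrightarrow> A \<preceq> C \<Longrightarrow> B \<preceq> D \<Longrightarrow>
    \<sigma> A B \<preceq> \<sigma> C D"
  using connection unfolding connection_def by blast

lemma conn_transformer:
  "A \<in> pos_ops \<Longrightarrow> B \<in> pos_ops \<Longrightarrow> C \<in> pos_ops \<Longrightarrow>
    C o\<^sub>L \<sigma> A B o\<^sub>L C \<preceq> \<sigma> (C o\<^sub>L A o\<^sub>L C) (C o\<^sub>L B o\<^sub>L C)"
  using connection unfolding connection_def by blast

lemma conn_continuous:
  "range As \<subseteq> pos_ops \<Longrightarrow> range Bs \<subseteq> pos_ops \<Longrightarrow> A \<in> pos_ops \<Longrightarrow> B \<in> pos_ops \<Longrightarrow>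
    decreases_to As A \<Longrightarrow> decreases_to Bs B \<Longrightarrow>
    decreases_to (\<lambda>n. \<sigma> (As n) (Bs n)) (\<sigma> A B)"
  using connection unfolding connection_def by blast

lemma conn_scalar: "0 \<le> x \<Longrightarrow> \<sigma> id_blinfun (x *\<^sub>R id_blinfun) = f x *\<^sub>R id_blinfun"
  using representing by (simp add: representing_function_def)

lemma operator_monotone_f: "operator_monotone f"
  using representing by (simp add: representing_function_def)

lemma f_nonneg: "0 \<le> x \<Longrightarrow> 0 \<le> f x"
  using operator_monotone_f by (auto simp: operator_monotone_def)

lemma continuous_on_f: "S \<subseteq> {0..} \<Longrightarrow> continuous_on S f"
  using operator_monotone_f by (auto simp: operator_monotone_def intro: continuous_on_subset)

text \<open>The transformer inequality for C gives one estimate. Applied with the inverse D to the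
  transformed pair and conjugated back by C, it gives the other.\<close>

lemma conn_congruence:
  assumes C: "C \<in> pos_ops" and D: "D \<in> pos_ops"
    and CD: "C o\<^sub>L D = id_blinfun" and DC: "D o\<^sub>L C = id_blinfun"
    and X: "X \<in> pos_ops" and Y: "Y \<in> pos_ops"
  shows "\<sigma> (C o\<^sub>L X o\<^sub>L C) (C o\<^sub>L Y o\<^sub>L C) = C o\<^sub>L \<sigma> X Y o\<^sub>L C"
proof -
  note sC = pos_ops_self_adjoint [OF C] and sD = pos_ops_self_adjoint [OF D]
  have cd: "C (D x) = x" "D (C x) = x" for x
    using CD DC by (metis blinfun_apply_blinfun_compose blinfun_apply_id_blinfun)+
  have CX: "C o\<^sub>L X o\<^sub>L C \<in> pos_ops" and CY: "C o\<^sub>L Y o\<^sub>L C \<in> pos_ops"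
    by (intro pos_ops_sandwich sC X Y)+
  define S where "S = \<sigma> (C o\<^sub>L X o\<^sub>L C) (C o\<^sub>L Y o\<^sub>L C)"
  have S: "S \<in> pos_ops" unfolding S_def by (rule conn_pos [OF CX CY])
  have "D o\<^sub>L S o\<^sub>L D \<preceq> \<sigma> (D o\<^sub>L (C o\<^sub>L X o\<^sub>L C) o\<^sub>L D) (D o\<^sub>L (C o\<^sub>L Y o\<^sub>L C) o\<^sub>L D)"
    unfolding S_def by (rule conn_transformer [OF CX CY D])
  also have "D o\<^sub>L (C o\<^sub>L X o\<^sub>L C) o\<^sub>L D = X" by (rule blinfun_eqI) (simp add: cd)
  also have "D o\<^sub>L (C o\<^sub>L Y o\<^sub>L C) o\<^sub>L D = Y" by (rule blinfun_eqI) (simp add: cd)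
  finally have DSD: "D o\<^sub>L S o\<^sub>L D \<preceq> \<sigma> X Y" .
  have "S = C o\<^sub>L \<sigma> X Y o\<^sub>L C"
  proof (rule op_le_antisym)
    show s1: "self_adjoint S" by (rule pos_ops_self_adjoint [OF S])
    show s2: "self_adjoint (C o\<^sub>L \<sigma> X Y o\<^sub>L C)"
      by (intro self_adjoint_sandwich sC pos_ops_self_adjoint conn_pos X Y)
    show "C o\<^sub>L \<sigma> X Y o\<^sub>L C \<preceq> S" unfolding S_def by (rule conn_transformer [OF X Y C])
    show "S \<preceq> C o\<^sub>L \<sigma> X Y o\<^sub>L C"
      unfolding op_le_iff [OF s1 s2]
    proof
      fix x
      have "inner (S x) x = inner ((D o\<^sub>L S o\<^sub>L D) (C x)) (C x)"
        by (simp add: cd self_adjointD [OF sD])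
      also have "\<dots> \<le> inner (\<sigma> X Y (C x)) (C x)" by (rule op_le_form [OF DSD])
      also have "\<dots> = inner ((C o\<^sub>L \<sigma> X Y o\<^sub>L C) x) x"
        by (simp add: self_adjointD [OF sC, of "\<sigma> X Y (C x)" x])
      finally show "inner (S x) x \<le> inner ((C o\<^sub>L \<sigma> X Y o\<^sub>L C) x) x" .
    qed
  qed
  then show ?thesis by (simp add: S_def)
qed

text \<open>Functions of A commute with A, so 0 \<le> g \<le> 1 yields both g(A)^2 \<le> I and g(A)
  A g(A) \<le> A. These feed monotonicity after the transformer inequality.\<close>

lemma conn_compress:
  assumes A: "A \<in> pos_ops" and g: "continuous_on (real_spectrum A) g"
    and g01: "\<And>r. r \<in> real_spectrum A \<Longrightarrow> 0 \<le> g r \<and> g r \<le> 1"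
  shows "cfc g A o\<^sub>L \<sigma> id_blinfun A o\<^sub>L cfc g A \<preceq> \<sigma> id_blinfun A"
proof -
  note sA = pos_ops_self_adjoint [OF A]
  have G: "cfc g A \<in> pos_ops" using g01 by (intro cfc_nonneg sA g) auto
  note sG = pos_ops_self_adjoint [OF G]
  have gr: "continuous_on (real_spectrum A) (\<lambda>r. g r * c * g r)"
    "continuous_on (real_spectrum A) (\<lambda>r. g r * r * g r)" for c
    by (intro continuous_intros g)+
  have "cfc g A o\<^sub>L id_blinfun o\<^sub>L cfc g A \<preceq> cfc (\<lambda>_. 1) A"
    using cfc_sandwich_const [OF sA g, of 1] g01
    by (simp, intro cfc_mono sA) (auto intro!: mult_le_one continuous_intros g)
  then have 1: "cfc g A o\<^sub>L id_blinfun o\<^sub>L cfc g A \<preceq> id_blinfun" by (simp add: cfc_const [OF sA])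
  have "g r * r * g r \<le> r" if "r \<in> real_spectrum A" for r
  proof -
    have "g r * g r \<le> 1" using g01 [OF that] by (intro mult_le_one) auto
    from mult_right_mono [OF this real_spectrum_pos [OF A that]] show ?thesis by (simp add: mult_ac)
  qed
  then have "cfc g A o\<^sub>L A o\<^sub>L cfc g A \<preceq> cfc (\<lambda>r. r) A"
    unfolding cfc_sandwich_ident [OF sA g] by (intro cfc_mono sA gr continuous_intros)
  then have 2: "cfc g A o\<^sub>L A o\<^sub>L cfc g A \<preceq> A" by (simp add: cfc_ident [OF sA])
  show ?thesis
    by (rule op_le_trans [OF conn_transformer [OF pos_ops_id A G]])
      (intro conn_mono pos_ops_sandwich sG A pos_ops_id 1 2)
qed

text \<open>With \<open>g = 1 - \<psi>\<close> the operator \<open>S = T - g(A) T g(A) \<ge> 0\<close> has vanishing form on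
  the range of \<open>k(A)\<close>, so it vanishes there, and \<open>S k(A) = \<psi>(A) T k(A)\<close>.\<close>

lemma conn_local:
  assumes A: "A \<in> pos_ops" and \<psi>: "continuous_on (real_spectrum A) \<psi>"
    and k: "continuous_on (real_spectrum A) k"
    and \<psi>01: "\<And>r. r \<in> real_spectrum A \<Longrightarrow> 0 \<le> \<psi> r \<and> \<psi> r \<le> 1"
    and disj: "\<And>r. r \<in> real_spectrum A \<Longrightarrow> \<psi> r * k r = 0"
  shows "cfc \<psi> A (\<sigma> id_blinfun A (cfc k A x)) = 0"
proof -
  note sA = pos_ops_self_adjoint [OF A]
  define T where "T = \<sigma> id_blinfun A"
  define g where "g r = 1 - \<psi> r" for r
  have g: "continuous_on (real_spectrum A) g" unfolding g_def by (intro continuous_intros \<psi>)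
  have sg: "self_adjoint (cfc g A)" by (rule self_adjoint_cfc [OF sA g])
  have gA: "cfc g A y = y - cfc \<psi> A y" for y
    unfolding g_def by (simp add: cfc_diff [OF sA _ \<psi>] cfc_const [OF sA] op_simps)
  have "cfc \<psi> A (cfc k A x) = cfc (\<lambda>_. 0) A x"
    using cfc_cong [of A "\<lambda>r. \<psi> r * k r" "\<lambda>_. 0"] disj by (simp add: cfc_apply_mult sA \<psi> k)
  then have gk: "cfc g A (cfc k A x) = cfc k A x" by (simp add: gA cfc_const [OF sA])
  define S where "S = T - (cfc g A o\<^sub>L T o\<^sub>L cfc g A)"
  have "S \<in> pos_ops"
    using conn_compress [OF A g] \<psi>01 by (simp add: op_le_def S_def T_def g_def)
  moreover have "inner (S (cfc k A x)) (cfc k A x) = 0"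
    by (simp add: S_def op_simps gk inner_diff_left self_adjointD [OF sg])
  ultimately have "S (cfc k A x) = 0" by (rule pos_ops_form_zero)
  then have "T (cfc k A x) = cfc g A (T (cfc k A x))" by (simp add: S_def op_simps gk)
  then show ?thesis unfolding gA by (simp add: T_def)
qed

text \<open>Since c \<le> r wherever g is nonzero, c g(A)^2 \<le> A as well as g(A)^2 \<le> I.
  Transforming I \<sigma> c I = f(c) I by g(A) therefore stays below I \<sigma> A.\<close>

lemma conn_lower:
  assumes A: "A \<in> pos_ops" and g: "continuous_on (real_spectrum A) g" and c: "0 \<le> c"
    and g01: "\<And>r. r \<in> real_spectrum A \<Longrightarrow> 0 \<le> g r \<and> g r \<le> 1"
    and supp: "\<And>r. r \<in> real_spectrum A \<Longrightarrow> g r \<noteq> 0 \<Longrightarrow> c \<le> r"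
  shows "f c *\<^sub>R (cfc g A o\<^sub>L cfc g A) \<preceq> \<sigma> id_blinfun A"
proof -
  note sA = pos_ops_self_adjoint [OF A]
  have G: "cfc g A \<in> pos_ops" using g01 by (intro cfc_nonneg sA g) auto
  note sG = pos_ops_self_adjoint [OF G]
  have cI: "c *\<^sub>R id_blinfun \<in> pos_ops" by (intro pos_ops_scaleR pos_ops_id c)
  have gr: "continuous_on (real_spectrum A) (\<lambda>r. g r * c * g r)" for c
    by (intro continuous_intros g)+
  have "cfc g A o\<^sub>L id_blinfun o\<^sub>L cfc g A \<preceq> cfc (\<lambda>_. 1) A"
    using cfc_sandwich_const [OF sA g, of 1] g01
    by (simp, intro cfc_mono sA) (auto intro!: mult_le_one continuous_intros g)
  then have 1: "cfc g A o\<^sub>L id_blinfun o\<^sub>L cfc g A \<preceq> id_blinfun" by (simp add: cfc_const [OF sA])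
  have "g r * c * g r \<le> r" if r: "r \<in> real_spectrum A" for r
  proof (cases "g r = 0")
    case False
    have "g r * g r \<le> 1" using g01 [OF that] by (intro mult_le_one) auto
    from mult_right_mono [OF this c] supp [OF r False] show ?thesis by (simp add: mult_ac)
  qed (use real_spectrum_pos [OF A r] in simp)
  then have "cfc g A o\<^sub>L (c *\<^sub>R id_blinfun) o\<^sub>L cfc g A \<preceq> cfc (\<lambda>r. r) A"
    unfolding cfc_sandwich_const [OF sA g] by (intro cfc_mono sA gr continuous_intros)
  then have 2: "cfc g A o\<^sub>L (c *\<^sub>R id_blinfun) o\<^sub>L cfc g A \<preceq> A" by (simp add: cfc_ident [OF sA])
  have "cfc g A o\<^sub>L \<sigma> id_blinfun (c *\<^sub>R id_blinfun) o\<^sub>L cfc g A \<preceq> \<sigma> id_blinfun A"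
    by (rule op_le_trans [OF conn_transformer [OF pos_ops_id cI G]])
      (intro conn_mono pos_ops_sandwich sG A pos_ops_id cI 1 2)
  moreover have "cfc g A o\<^sub>L \<sigma> id_blinfun (c *\<^sub>R id_blinfun) o\<^sub>L cfc g A
      = f c *\<^sub>R (cfc g A o\<^sub>L cfc g A)"
    unfolding conn_scalar [OF c] by (rule blinfun_eqI) (simp add: op_simps)
  ultimately show ?thesis by simp
qed

text \<open>The transformer inequality bounds \<open>h(A) T h(A)\<close> by \<open>h(A)\<^sup>2 \<sigma> b h(A)\<^sup>2\<close>, which is
  computed after replacing \<open>h\<^sup>2\<close> by the invertible \<open>h\<^sup>2 + \<delta>\<close>.\<close>

lemma conn_upper:
  assumes A: "A \<in> pos_ops" and h: "continuous_on (real_spectrum A) h" and b: "0 \<le> b"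
    and h0: "\<And>r. r \<in> real_spectrum A \<Longrightarrow> 0 \<le> h r"
    and supp: "\<And>r. r \<in> real_spectrum A \<Longrightarrow> h r \<noteq> 0 \<Longrightarrow> r \<le> b"
  shows "inner (\<sigma> id_blinfun A (cfc h A x)) (cfc h A x) \<le> f b * (norm (cfc h A x))\<^sup>2"
proof -
  note sA = pos_ops_self_adjoint [OF A]
  have H: "cfc h A \<in> pos_ops" by (intro cfc_nonneg sA h h0)
  note sH = pos_ops_self_adjoint [OF H]
  have bI: "b *\<^sub>R id_blinfun \<in> pos_ops" by (intro pos_ops_scaleR pos_ops_id b)
  have approx: "inner (\<sigma> id_blinfun A (cfc h A x)) (cfc h A x)
      \<le> f b * ((norm (cfc h A x))\<^sup>2 + \<delta> * (norm x)\<^sup>2)" if \<delta>: "0 < \<delta>" for \<delta>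
  proof -
    \<comment> \<open>As the square root of h^2 + \<delta>, w is bounded away from zero, so w(A) has
      the inverse (1/w)(A) and \<open>conn_congruence\<close> applies.\<close>
    define w where "w r = sqrt (h r * h r + \<delta>)" for r
    have w: "continuous_on (real_spectrum A) w" unfolding w_def by (intro continuous_intros h)
    have w0: "0 < w r" for r unfolding w_def using \<delta> by (simp add: add_nonneg_pos)
    have ww: "w r * w r = h r * h r + \<delta>" for r
      unfolding w_def using \<delta> by (simp add: add_nonneg_nonneg)
    have v: "continuous_on (real_spectrum A) (\<lambda>r. 1 / w r)"
      using w0 by (intro continuous_intros w) (metis less_irrefl)
    have W: "cfc w A \<in> pos_ops" using w0 by (intro cfc_nonneg sA w less_imp_le)
    have V: "cfc (\<lambda>r. 1 / w r) A \<in> pos_ops" using w0 by (intro cfc_nonneg sA v) (simp add: less_imp_le)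
    have WV: "cfc w A o\<^sub>L cfc (\<lambda>r. 1 / w r) A = id_blinfun" "cfc (\<lambda>r. 1 / w r) A o\<^sub>L cfc w A = id_blinfun"
      unfolding cfc_mult [OF sA w v, symmetric] cfc_mult [OF sA v w, symmetric]
      using cfc_cong [of A _ "\<lambda>_. 1"] cfc_const [OF sA, of 1] w0 by (simp_all add: less_imp_neq [symmetric])
    note sW = pos_ops_self_adjoint [OF W]
    have "cfc h A o\<^sub>L (1 *\<^sub>R id_blinfun) o\<^sub>L cfc h A \<preceq> cfc w A o\<^sub>L (1 *\<^sub>R id_blinfun) o\<^sub>L cfc w A"
      unfolding cfc_sandwich_const [OF sA h] cfc_sandwich_const [OF sA w]
      using \<delta> by (intro cfc_mono sA continuous_intros h w) (simp add: ww)
    then have 1: "cfc h A o\<^sub>L id_blinfun o\<^sub>L cfc h A \<preceq> cfc w A o\<^sub>L id_blinfun o\<^sub>L cfc w A" by simp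
    \<comment> \<open>Where h is nonzero r \<le> b, and elsewhere the left side vanishes; the second
      argument is thus enlarged along with the first.\<close>
    have 2: "cfc h A o\<^sub>L A o\<^sub>L cfc h A \<preceq> cfc w A o\<^sub>L (b *\<^sub>R id_blinfun) o\<^sub>L cfc w A"
      unfolding cfc_sandwich_ident [OF sA h] cfc_sandwich_const [OF sA w]
    proof (intro cfc_mono sA continuous_intros h w)
      fix r assume r: "r \<in> real_spectrum A"
      have "r * (h r * h r) \<le> b * (h r * h r)"
        using supp [OF r] by (cases "h r = 0") (auto intro: mult_right_mono)
      also have "\<dots> \<le> b * (w r * w r)" unfolding ww using b \<delta> by (intro mult_left_mono) auto
      finally show "h r * r * h r \<le> w r * b * w r" by (simp add: mult_ac)
    qed
    have "cfc h A o\<^sub>L \<sigma> id_blinfun A o\<^sub>L cfc h A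
        \<preceq> \<sigma> (cfc h A o\<^sub>L id_blinfun o\<^sub>L cfc h A) (cfc h A o\<^sub>L A o\<^sub>L cfc h A)"
      by (rule conn_transformer [OF pos_ops_id A H])
    also have "\<dots> \<preceq> \<sigma> (cfc w A o\<^sub>L id_blinfun o\<^sub>L cfc w A) (cfc w A o\<^sub>L (b *\<^sub>R id_blinfun) o\<^sub>L cfc w A)"
      by (intro conn_mono pos_ops_sandwich sH sW A bI pos_ops_id 1 2)
    also have "\<dots> = cfc w A o\<^sub>L (f b *\<^sub>R id_blinfun) o\<^sub>L cfc w A"
      unfolding conn_congruence [OF W V WV pos_ops_id bI] conn_scalar [OF b] ..
    finally have le: "cfc h A o\<^sub>L \<sigma> id_blinfun A o\<^sub>L cfc h A
        \<preceq> cfc w A o\<^sub>L (f b *\<^sub>R id_blinfun) o\<^sub>L cfc w A" .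
    have "inner (\<sigma> id_blinfun A (cfc h A x)) (cfc h A x)
        = inner ((cfc h A o\<^sub>L \<sigma> id_blinfun A o\<^sub>L cfc h A) x) x"
      by (simp add: self_adjointD [OF sH, of "\<sigma> id_blinfun A _" x])
    also have "\<dots> \<le> inner ((cfc w A o\<^sub>L (f b *\<^sub>R id_blinfun) o\<^sub>L cfc w A) x) x"
      by (rule op_le_form [OF le])
    also have "\<dots> = f b * inner (cfc (\<lambda>r. w r * w r) A x) x"
      by (simp add: op_simps cfc_mult [OF sA w w])
    also have "cfc (\<lambda>r. w r * w r) A = cfc (\<lambda>r. h r * h r) A + \<delta> *\<^sub>R id_blinfun"
      unfolding ww using cfc_add [OF sA _ continuous_on_const, of "\<lambda>r. h r * h r" \<delta>] h
      by (simp add: cfc_const [OF sA] continuous_on_mult)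
    finally show ?thesis
      by (simp add: op_simps inner_add_left norm_cfc_sq [OF sA h] dot_square_norm)
  qed
  show ?thesis
  proof (rule field_le_epsilon)
    fix e :: real assume e: "0 < e"
    \<comment> \<open>K is the coefficient of \<delta> in \<open>approx\<close>; with \<delta> =
      e/(K + 1) the extra term is at most e, also when K = 0.\<close>
    define K where "K = f b * (norm x)\<^sup>2"
    have K: "0 \<le> K" unfolding K_def by (intro mult_nonneg_nonneg f_nonneg b) simp
    have "K * (e / (K + 1)) \<le> e" using K e by (simp add: field_simps add_nonneg_pos)
    moreover have "0 < e / (K + 1)" using K e by simp
    ultimately show "inner (\<sigma> id_blinfun A (cfc h A x)) (cfc h A x)
        \<le> f b * (norm (cfc h A x))\<^sup>2 + e"
      using approx [of "e / (K + 1)"] by (simp add: K_def algebra_simps)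
  qed
qed


text \<open>Both h and k live where the ramp g equals 1, so on these vectors the positive operator S
  = T - f(c) g(A)^2 acts as T - f(c). Its form there is at most f(b) - f(c) \<le> \<eta> times the
  squared norm, and Cauchy-Schwarz extends this to the pair. The operator f(A) - f(c) adds a second
  \<eta>. The margin \<epsilon> at the left end is the room in which g climbs from 0 to 1.\<close>

lemma conn_pair_bound:
  assumes A: "A \<in> pos_ops" and \<epsilon>: "0 < \<epsilon>" and b: "0 \<le> b" "a \<le> b" and \<eta>: "0 \<le> \<eta>"
    and h: "continuous_on (real_spectrum A) h" "\<And>r. r \<in> real_spectrum A \<Longrightarrow> 0 \<le> h r"
      "\<And>r. r \<in> real_spectrum A \<Longrightarrow> h r \<noteq> 0 \<Longrightarrow> a + \<epsilon> \<le> r \<and> r \<le> b"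
    and k: "continuous_on (real_spectrum A) k" "\<And>r. r \<in> real_spectrum A \<Longrightarrow> 0 \<le> k r"
      "\<And>r. r \<in> real_spectrum A \<Longrightarrow> k r \<noteq> 0 \<Longrightarrow> a + \<epsilon> \<le> r \<and> r \<le> b"
    and osc: "\<And>s t. s \<in> {max 0 a..b} \<Longrightarrow> t \<in> {max 0 a..b} \<Longrightarrow> \<bar>f s - f t\<bar> \<le> \<eta>"
  shows "\<bar>inner ((\<sigma> id_blinfun A - cfc f A) (cfc h A x)) (cfc k A y)\<bar>
    \<le> 2 * \<eta> * (norm (cfc h A x) * norm (cfc k A y))"
proof -
  note sA = pos_ops_self_adjoint [OF A]
  \<comment> \<open>Near the bottom of the spectrum a may be negative, whereas f is controlled for
    nonnegative arguments only; hence the cut at 0.\<close>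
  define T c where "T = \<sigma> id_blinfun A" and "c = max 0 a"
  have c: "0 \<le> c" "c \<le> b" using b by (auto simp: c_def)
  define g where "g r = min 1 (max 0 ((r - a) / \<epsilon>))" for r
  have g: "continuous_on (real_spectrum A) g"
    unfolding g_def using \<epsilon> by (intro continuous_intros) auto
  have low: "f c *\<^sub>R (cfc g A o\<^sub>L cfc g A) \<preceq> T"
    unfolding T_def
  proof (rule conn_lower [OF A g c(1)])
    fix r assume r: "r \<in> real_spectrum A"
    show "0 \<le> g r \<and> g r \<le> 1" by (simp add: g_def)
    assume "g r \<noteq> 0"
    then have "0 < (r - a) / \<epsilon>" by (auto simp: g_def max_def split: if_splits)
    then show "c \<le> r"
      using \<epsilon> real_spectrum_pos [OF A r] by (simp add: c_def zero_less_divide_iff)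
  qed
  define S where "S = T - f c *\<^sub>R (cfc g A o\<^sub>L cfc g A)"
  have S: "S \<in> pos_ops" using low by (simp add: S_def op_le_def)
  have act: "S (cfc k A x) = T (cfc k A x) - f c *\<^sub>R cfc k A x"
    and diag: "inner (S (cfc k A x)) (cfc k A x) \<le> \<eta> * (norm (cfc k A x))\<^sup>2"
    if k: "continuous_on (real_spectrum A) k" "\<And>r. r \<in> real_spectrum A \<Longrightarrow> 0 \<le> k r"
      "\<And>r. r \<in> real_spectrum A \<Longrightarrow> k r \<noteq> 0 \<Longrightarrow> a + \<epsilon> \<le> r \<and> r \<le> b" for k x
  proof -
    have gk: "g r * k r = k r" if "r \<in> real_spectrum A" for r
    proof (cases "k r = 0")
      case False
      then have "1 \<le> (r - a) / \<epsilon>" using k(3) [OF that] \<epsilon> by (simp add: pos_le_divide_eq)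
      then show ?thesis by (simp add: g_def)
    qed simp
    have "cfc g A (cfc k A x) = cfc k A x"
      unfolding cfc_apply_mult [OF sA g k(1)] using cfc_cong [of A "\<lambda>r. g r * k r" k] gk by simp
    then show act: "S (cfc k A x) = T (cfc k A x) - f c *\<^sub>R cfc k A x"
      by (simp add: S_def op_simps)
    have "inner (T (cfc k A x)) (cfc k A x) \<le> f b * (norm (cfc k A x))\<^sup>2"
      unfolding T_def using k by (intro conn_upper A b) auto
    then have "inner (S (cfc k A x)) (cfc k A x) \<le> (f b - f c) * (norm (cfc k A x))\<^sup>2"
      unfolding act by (simp add: inner_diff_left dot_square_norm left_diff_distrib)
    also have "\<dots> \<le> \<eta> * (norm (cfc k A x))\<^sup>2"
      using osc [of b c] c by (intro mult_right_mono) (auto simp: c_def)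
    finally show "inner (S (cfc k A x)) (cfc k A x) \<le> \<eta> * (norm (cfc k A x))\<^sup>2" .
  qed
  define u w where "u = cfc h A x" and "w = cfc k A y"
  have "(inner (S u) w)\<^sup>2 \<le> inner (S u) u * inner (S w) w"
    by (rule pos_ops_Cauchy_Schwarz [OF S])
  also have "\<dots> \<le> (\<eta> * (norm u)\<^sup>2) * (\<eta> * (norm w)\<^sup>2)"
    unfolding u_def w_def using \<eta> by (intro mult_mono diag h k pos_ops_nonneg [OF S]) auto
  also have "\<dots> = (\<eta> * (norm u * norm w))\<^sup>2" by (simp add: power2_eq_square)
  finally have 1: "\<bar>inner (S u) w\<bar> \<le> \<eta> * (norm u * norm w)"
    using \<eta> by (subst (asm) power2_le_iff_abs_le) auto
  \<comment> \<open>Clipping to [-\<eta>, \<eta>] changes nothing where h is nonzero, but it bounds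
    q on the whole spectrum, so that q(A) has norm at most \<eta>.\<close>
  define q where "q r = max (- \<eta>) (min \<eta> (f r - f c))" for r
  have fA: "continuous_on (real_spectrum A) f"
    using real_spectrum_pos [OF A] by (intro continuous_on_f) auto
  then have q: "continuous_on (real_spectrum A) q"
    unfolding q_def by (intro continuous_intros)
  have "f r * h r - f c * h r = q r * h r" if r: "r \<in> real_spectrum A" for r
  proof (cases "h r = 0")
    case False
    then have "\<bar>f r - f c\<bar> \<le> \<eta>"
      using h(3) [OF r] real_spectrum_pos [OF A r] \<epsilon> c by (intro osc) (auto simp: c_def)
    then have "q r = f r - f c" by (auto simp: q_def)
    then show ?thesis by (simp add: left_diff_distrib)
  qed simp
  then have "cfc (\<lambda>r. f r * h r - f c * h r) A x = cfc (\<lambda>r. q r * h r) A x"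
    using cfc_cong [of A "\<lambda>r. f r * h r - f c * h r" "\<lambda>r. q r * h r"] by simp
  then have fu: "cfc f A u - f c *\<^sub>R u = cfc q A u"
    unfolding u_def cfc_apply_mult [OF sA fA h(1)] cfc_apply_mult [OF sA q h(1)]
    by (subst (asm) cfc_diff)
      (auto simp: sA fA h cfc_scaleR [OF sA h(1)] op_simps intro!: continuous_intros)
  have "norm (cfc q A) \<le> \<eta>"
    using \<eta> by (intro cfc_norm_le sA q) (auto simp: q_def)
  then have "norm (cfc q A u) \<le> \<eta> * norm u"
    by (rule order_trans [OF norm_blinfun mult_right_mono]) simp
  then have "norm (cfc q A u) * norm w \<le> \<eta> * norm u * norm w"
    by (rule mult_right_mono) simp
  with Cauchy_Schwarz_ineq2 [of "cfc q A u" w]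
  have 2: "\<bar>inner (cfc q A u) w\<bar> \<le> \<eta> * (norm u * norm w)" by (simp add: mult.assoc)
  have "(T - cfc f A) u = S u - cfc q A u"
    unfolding fu [symmetric] using act [OF h, of x] by (simp add: op_simps u_def)
  then have "inner ((T - cfc f A) u) w = inner (S u) w - inner (cfc q A u) w"
    by (simp add: inner_diff_left)
  with 1 2 show ?thesis unfolding u_def w_def T_def by linarith
qed

text \<open>A partition of unity by hat functions \<open>h\<^sub>i\<close> splits the form of \<open>D = I \<sigma> A - f(A)\<close> into
  the terms \<open>\<langle>D h\<^sub>i(A) v, h\<^sub>j(A) v\<rangle>\<close>: those with \<open>|i - j| \<ge> 2\<close> vanish by locality, and the
  others are controlled by the oscillation of \<open>f\<close> on short intervals.\<close>

lemma conn_form_bound: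
  assumes A: "A \<in> pos_ops" and \<eta>: "0 < \<eta>"
  shows "\<bar>inner ((\<sigma> id_blinfun A - cfc f A) v) v\<bar> \<le> 6 * \<eta> * (norm v)\<^sup>2"
proof -
  note sA = pos_ops_self_adjoint [OF A]
  define D where "D = \<sigma> id_blinfun A - cfc f A"
  define m where "m = norm A"
  have sp: "0 \<le> r \<and> r \<le> m" if "r \<in> real_spectrum A" for r
    using real_spectrum_pos [OF A that] real_spectrum_le_norm [OF sA that] by (simp add: m_def)
  have m: "0 \<le> m" by (simp add: m_def)
  \<comment> \<open>The intervals [a, b] chosen for neighbouring hats reach beyond the spectrum, up
    to at most m + 4.\<close>
  have "uniformly_continuous_on {0..m + 4} f"
    by (intro compact_uniformly_continuous continuous_on_f) auto
  then obtain d where d: "0 < d"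
    "\<And>s t. s \<in> {0..m + 4} \<Longrightarrow> t \<in> {0..m + 4} \<Longrightarrow> \<bar>s - t\<bar> < d \<Longrightarrow> \<bar>f s - f t\<bar> < \<eta>"
    using \<eta> unfolding uniformly_continuous_on_def dist_real_def by metis
  \<comment> \<open>Those intervals have length 4 \<epsilon>, which must be less than d.\<close>
  define \<epsilon> where "\<epsilon> = min 1 (d / 5)"
  have \<epsilon>: "0 < \<epsilon>" "\<epsilon> \<le> 1" "4 * \<epsilon> < d" using d(1) by (auto simp: \<epsilon>_def min_def)
  define N where "N = nat \<lceil>m / \<epsilon>\<rceil>"
  have "0 \<le> m / \<epsilon>" using m \<epsilon> by simp
  then have "m / \<epsilon> \<le> N" "N \<le> m / \<epsilon> + 1" unfolding N_def by linarith+
  then have N: "m / \<epsilon> \<le> N" "N * \<epsilon> \<le> m + \<epsilon>" using \<epsilon> by (auto simp: field_simps)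
  define ramp :: "real \<Rightarrow> real" where "ramp z = min 1 (max 0 z)" for z
  \<comment> \<open>A difference of two shifted ramps is the hat with peak at i \<epsilon> and zeros
    at the neighbouring nodes; in this form the sum over i telescopes.\<close>
  define h where "h i r = ramp (r / \<epsilon> - real i + 1) - ramp (r / \<epsilon> - real i)" for i r
  have cont: "continuous_on (real_spectrum A) (h i)" for i
    unfolding h_def ramp_def using \<epsilon> by (intro continuous_intros) auto
  have h01: "0 \<le> h i r" "h i r \<le> 1" for i r by (auto simp: h_def ramp_def)
  have supp: "(real i - 1) * \<epsilon> < r \<and> r < (real i + 1) * \<epsilon>" if "h i r \<noteq> 0" for i r
  proof -
    have "real i - 1 < r / \<epsilon> \<and> r / \<epsilon> < real i + 1"
    proof (rule ccontr)
      assume "\<not> ?thesis"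
      then have "h i r = 0" by (auto simp: h_def ramp_def)
      with that show False by simp
    qed
    then show ?thesis using \<epsilon> by (simp add: field_simps)
  qed
  have part: "(\<Sum>i\<le>N. h i r) = 1" if "r \<in> real_spectrum A" for r
  proof -
    have "(\<Sum>i\<le>N. h i r) = (\<Sum>i\<le>N. ramp (r / \<epsilon> - real i + 1) - ramp (r / \<epsilon> - real (Suc i) + 1))"
      by (simp add: h_def)
    also have "\<dots> = ramp (r / \<epsilon> + 1) - ramp (r / \<epsilon> - N)"
      by (subst sum_telescope) simp
    also have "\<dots> = 1"
    proof -
      have "0 \<le> r / \<epsilon>" "r / \<epsilon> \<le> m / \<epsilon>" using sp [OF that] \<epsilon> by (auto intro: divide_right_mono)
      with N show ?thesis by (simp add: ramp_def)
    qed
    finally show ?thesis .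
  qed
  have fA: "continuous_on (real_spectrum A) f" using sp by (intro continuous_on_f) auto
  define w where "w i = cfc (h i) A v" for i
  have "(\<Sum>i\<le>N. w i) = cfc (\<lambda>r. \<Sum>i\<le>N. h i r) A v"
    by (simp add: cfc_sum [OF sA cont] w_def blinfun.sum_left)
  also have "\<dots> = cfc (\<lambda>_. 1) A v" using cfc_cong [of A "\<lambda>r. \<Sum>i\<le>N. h i r" "\<lambda>_. 1"] part by simp
  finally have v: "v = (\<Sum>i\<le>N. w i)" by (simp add: cfc_const [OF sA])
  \<comment> \<open>Because h i squared is at most h i and the hats sum to 1, the squared norms of
    the pieces add up to at most that of v, however fine the mesh.\<close>
  have "(\<Sum>i\<le>N. (norm (w i))\<^sup>2) \<le> (\<Sum>i\<le>N. inner (w i) v)"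
  proof (rule sum_mono)
    fix i
    have "cfc (\<lambda>r. h i r * h i r) A \<preceq> cfc (h i) A"
      using h01 by (intro cfc_mono sA cont continuous_intros) (simp add: mult_left_le)
    then show "(norm (w i))\<^sup>2 \<le> inner (w i) v"
      unfolding w_def norm_cfc_sq [OF sA cont] by (rule op_le_form)
  qed
  also have "\<dots> = inner (\<Sum>i\<le>N. w i) v" by (simp add: inner_sum_left)
  also have "\<dots> = (norm v)\<^sup>2" by (simp add: v [symmetric] power2_norm_eq_inner)
  finally have sq: "(\<Sum>i\<le>N. (norm (w i))\<^sup>2) \<le> (norm v)\<^sup>2" .
  have far: "inner (D (w i)) (w j) = 0" if "\<not> (i \<le> Suc j \<and> j \<le> Suc i)" for i j
  proof -
    have disj: "h j r * h i r = 0" for r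
    proof (rule ccontr)
      assume "h j r * h i r \<noteq> 0"
      then have "(real i - 1) * \<epsilon> < (real j + 1) * \<epsilon>" "(real j - 1) * \<epsilon> < (real i + 1) * \<epsilon>"
        using supp [of i r] supp [of j r] by auto
      then have "real i - 1 < real j + 1" "real j - 1 < real i + 1" using \<epsilon> by auto
      with that show False by auto
    qed
    \<comment> \<open>The summand f(A) of D drops out because h j f h i = 0; the summand I \<sigma>
      A drops out by \<open>conn_local\<close>.\<close>
    have "cfc (h j) A (cfc f A (w i)) = cfc (\<lambda>r. h j r * (f r * h i r)) A v"
      unfolding w_def cfc_apply_mult [OF sA fA cont]
      by (intro cfc_apply_mult sA cont continuous_on_mult fA)
    also have "(\<lambda>r. h j r * (f r * h i r)) = (\<lambda>_. 0)"
      using disj by (metis mult.commute mult.left_commute mult_zero_right)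
    finally have "cfc (h j) A (D (w i)) = 0"
      using conn_local [OF A cont cont _ disj, of v] h01
      by (simp add: D_def op_simps cfc_const [OF sA] w_def)
    then show ?thesis
      unfolding w_def using self_adjointD [OF self_adjoint_cfc [OF sA cont]] by (metis inner_zero_left)
  qed
  have near: "\<bar>inner (D (w i)) (w j)\<bar> \<le> \<eta> * ((norm (w i))\<^sup>2 + (norm (w j))\<^sup>2)"
    if ij: "i \<le> N" "j \<le> N" "i \<le> Suc j" "j \<le> Suc i" for i j
  proof -
    define l where "l = min i j"
    have l: "real l \<le> real i" "real i \<le> real l + 1" "real l \<le> real j" "real j \<le> real l + 1" "l \<le> N"
      using ij by (auto simp: l_def)
    \<comment> \<open>The hats l and l + 1 together occupy the range from (l - 1) \<epsilon> to (l +
      2) \<epsilon>; one further \<epsilon> on the left is the margin of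
      \<open>conn_pair_bound\<close>.\<close>
    define a b where "a = (real l - 2) * \<epsilon>" and "b = (real l + 2) * \<epsilon>"
    have "real l * \<epsilon> \<le> N * \<epsilon>" using l \<epsilon> by (intro mult_right_mono) auto
    then have "b \<le> m + 4" using \<epsilon> N unfolding b_def distrib_right by linarith
    then have b: "0 \<le> b" "a \<le> b" "b \<le> m + 4" "b - a = 4 * \<epsilon>"
      using \<epsilon> by (auto simp: a_def b_def algebra_simps)
    have hs: "a + \<epsilon> \<le> r \<and> r \<le> b" if "h k r \<noteq> 0" "real l \<le> real k" "real k \<le> real l + 1" for k r
    proof -
      have "a + \<epsilon> = (real l - 1) * \<epsilon>" by (simp add: a_def algebra_simps)
      also have "\<dots> \<le> (real k - 1) * \<epsilon>" using that \<epsilon> by (intro mult_right_mono) auto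
      finally have "a + \<epsilon> \<le> r" using supp [OF that(1)] by simp
      moreover have "(real k + 1) * \<epsilon> \<le> b" unfolding b_def using that \<epsilon> by (intro mult_right_mono) auto
      ultimately show ?thesis using supp [OF that(1)] by simp
    qed
    have osc: "\<bar>f s - f t\<bar> \<le> \<eta>" if "s \<in> {max 0 a..b}" "t \<in> {max 0 a..b}" for s t
      using that b \<epsilon> by (intro less_imp_le d(2)) auto
    have "\<bar>inner (D (w i)) (w j)\<bar> \<le> 2 * \<eta> * (norm (w i) * norm (w j))"
      unfolding D_def w_def
      by (rule conn_pair_bound [OF A \<epsilon>(1) b(1,2) less_imp_le [OF \<eta>]]) (use cont h01 hs l osc in auto)
    also have "\<dots> \<le> \<eta> * ((norm (w i))\<^sup>2 + (norm (w j))\<^sup>2)"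
      using mult_left_mono [OF sum_squares_bound [of "norm (w i)" "norm (w j)"], of \<eta>] \<eta>
      by (simp add: mult_ac)
    finally show ?thesis .
  qed
  have "inner (D v) v = (\<Sum>i\<le>N. \<Sum>j\<le>N. inner (D (w i)) (w j))"
    by (subst (1 2) v) (simp add: blinfun.sum_right inner_sum_left inner_sum_right, rule sum.swap)
  also have "\<bar>\<dots>\<bar> \<le> 6 * \<eta> * (\<Sum>i\<le>N. (norm (w i))\<^sup>2)"
    using \<eta> near far by (intro tridiagonal_sum_bound) auto
  also have "\<dots> \<le> 6 * \<eta> * (norm v)\<^sup>2" using sq \<eta> by (intro mult_left_mono) auto
  finally show ?thesis by (simp add: D_def)
qed

theorem conn_eq_cfc:
  assumes A: "A \<in> pos_ops"
  shows "\<sigma> id_blinfun A = cfc f A"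
proof -
  define D where "D = \<sigma> id_blinfun A - cfc f A"
  have "continuous_on (real_spectrum A) f"
    using real_spectrum_pos [OF A] by (intro continuous_on_f) auto
  then have sD: "self_adjoint D"
    unfolding D_def by (intro self_adjoint_diff self_adjoint_cfc pos_ops_self_adjoint conn_pos A pos_ops_id)
  have "inner (D v) v = 0" for v
  proof (rule ccontr)
    assume nz: "inner (D v) v \<noteq> 0"
    define K n where "K = \<bar>inner (D v) v\<bar>" and "n = (norm v)\<^sup>2"
    have K: "0 < K" and n: "0 \<le> n" using nz by (auto simp: K_def n_def)
    \<comment> \<open>With \<eta> = K/(6 (n + 1)) the form bound reads K \<le> K n/(n + 1),
      impossible for K > 0.\<close>
    have "K \<le> 6 * (K / (6 * (n + 1))) * n"
      unfolding K_def D_def n_def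
      by (intro conn_form_bound A) (fold n_def D_def, fold K_def, use K n in simp)
    also have "\<dots> < K" using K n by (simp add: field_simps)
    finally show False by simp
  qed
  then have "D = 0" by (rule self_adjoint_form_zero [OF sD])
  then show ?thesis by (simp add: D_def)
qed

end

section \<open>Reduction by the square root of A\<close>

lemma strictly_pos_powr:
  assumes A: "A \<in> strictly_pos_ops"
  defines "R \<equiv> op_powr A (1/2)" and "V \<equiv> op_powr A (- 1/2)"
  shows "R \<in> pos_ops" "V \<in> pos_ops" "R o\<^sub>L R = A" "R o\<^sub>L V = id_blinfun" "V o\<^sub>L R = id_blinfun"
proof -
  have Ap: "A \<in> pos_ops" and inv: "invertible_op A" using A by (auto simp: strictly_pos_ops_def)
  note sA = pos_ops_self_adjoint [OF Ap]
  have "0 \<notin> real_spectrum A" using inv by (simp add: real_spectrum_def spectrum_def)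
  then have sp: "0 < r" if "r \<in> real_spectrum A" for r
    using real_spectrum_pos [OF Ap that] that by (cases "r = 0") auto
  have c: "continuous_on (real_spectrum A) (\<lambda>r. r powr p)" for p :: real
    using sp by (intro continuous_intros) auto
  show "R \<in> pos_ops" "V \<in> pos_ops"
    unfolding R_def V_def op_powr_def by (auto intro!: cfc_nonneg sA c)
  have prod: "op_powr A p o\<^sub>L op_powr A q = cfc (\<lambda>r. r powr (p + q)) A" for p q
    unfolding op_powr_def cfc_mult [OF sA c c, symmetric] powr_add ..
  have "cfc (\<lambda>r. r powr 1) A = cfc (\<lambda>r. r) A"
    using sp by (intro cfc_cong) (simp add: less_imp_le)
  then show "R o\<^sub>L R = A"
    using prod [of "1/2" "1/2"] by (simp add: R_def cfc_ident [OF sA])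
  \<comment> \<open>As \<open>0 powr 0\<close> is 0, this uses that 0 is not in the
    spectrum.\<close>
  have "cfc (\<lambda>r. r powr 0) A = cfc (\<lambda>_. 1) A"
    using sp by (intro cfc_cong) (auto dest: less_imp_neq)
  then show "R o\<^sub>L V = id_blinfun" "V o\<^sub>L R = id_blinfun"
    using prod [of "1/2" "-1/2"] prod [of "-1/2" "1/2"]
    by (simp_all add: R_def V_def cfc_const [OF sA])
qed

context represented_connection
begin

text \<open>Write A = R I R and X = R (V X V) R; congruence by R moves \<sigma> to the pair I, V X
  V, where it is given by f.\<close>

lemma conn_eq_sandwich:
  assumes A: "A \<in> strictly_pos_ops" and X: "X \<in> pos_ops"
  defines "R \<equiv> op_powr A (1/2)" and "V \<equiv> op_powr A (- 1/2)"
  shows "\<sigma> A X = R o\<^sub>L cfc f (V o\<^sub>L X o\<^sub>L V) o\<^sub>L R"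
proof -
  note RV = strictly_pos_powr [OF A, folded R_def V_def]
  have rv: "R (V x) = x" "V (R x) = x" for x
    using RV(4,5) by (metis blinfun_apply_blinfun_compose blinfun_apply_id_blinfun)+
  have Y: "V o\<^sub>L X o\<^sub>L V \<in> pos_ops" by (intro pos_ops_sandwich pos_ops_self_adjoint RV X)
  have "R o\<^sub>L id_blinfun o\<^sub>L R = A" unfolding RV(3) [symmetric] by (rule blinfun_eqI) simp
  moreover have "R o\<^sub>L (V o\<^sub>L X o\<^sub>L V) o\<^sub>L R = X" by (rule blinfun_eqI) (simp add: rv)
  ultimately show ?thesis
    using conn_congruence [OF RV(1,2,4,5) pos_ops_id Y] conn_eq_cfc [OF Y] by simp
qed

text \<open>For invertible A the sandwich formula with f(Y) = c I gives c R R = c A. A general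
  positive A is the decreasing limit of the invertible operators A + I/(n + 1), and the continuity
  axiom carries the identity over.\<close>

lemma scalar_multiple_of_left_trivial_if_const:
  assumes const: "\<And>t. 0 \<le> t \<Longrightarrow> f t = c"
  shows "scalar_multiple_of_left_trivial \<sigma>"
  unfolding scalar_multiple_of_left_trivial_def
proof (intro exI conjI ballI)
  show "0 \<le> c" using f_nonneg [of 0] const [of 0] by simp
  have strict: "\<sigma> A X = c *\<^sub>R A" if A: "A \<in> strictly_pos_ops" and X: "X \<in> pos_ops" for A X
  proof -
    define R V where "R = op_powr A (1/2)" and "V = op_powr A (- 1/2)"
    note RV = strictly_pos_powr [OF A, folded R_def V_def]
    have Y: "V o\<^sub>L X o\<^sub>L V \<in> pos_ops" by (intro pos_ops_sandwich pos_ops_self_adjoint RV X)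
    have "cfc f (V o\<^sub>L X o\<^sub>L V) = cfc (\<lambda>_. c) (V o\<^sub>L X o\<^sub>L V)"
      using real_spectrum_pos [OF Y] const by (intro cfc_cong) auto
    also have "\<dots> = c *\<^sub>R id_blinfun" by (rule cfc_const [OF pos_ops_self_adjoint [OF Y]])
    finally have "\<sigma> A X = R o\<^sub>L (c *\<^sub>R id_blinfun) o\<^sub>L R"
      using conn_eq_sandwich [OF A X] by (simp add: R_def V_def)
    also have "\<dots> = c *\<^sub>R (R o\<^sub>L R)" by (rule blinfun_eqI) (simp add: op_simps)
    finally show ?thesis unfolding RV(3) .
  qed
  fix A X :: "'h op" assume A: "A \<in> pos_ops" and X: "X \<in> pos_ops"
  define An where "An n = A + inverse (real (Suc n)) *\<^sub>R id_blinfun" for n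
  have An_pos: "An n \<in> pos_ops" for n
    unfolding An_def by (intro pos_ops_add A pos_ops_scaleR pos_ops_id) simp
  have "invertible_op (An n)" for n
  proof (rule Lax_Milgram)
    show "An n \<in> bounded_ops" by (intro self_adjoint_bounded_ops pos_ops_self_adjoint An_pos)
    show "0 < inverse (real (Suc n))" by simp
    show "inverse (real (Suc n)) * (norm x)\<^sup>2 \<le> inner (An n x) x" for x
      using pos_ops_nonneg [OF A, of x] by (simp add: An_def op_simps inner_add_left dot_square_norm)
  qed
  then have An: "An n \<in> strictly_pos_ops" for n by (simp add: strictly_pos_ops_def An_pos)
  have lim: "(\<lambda>n. An n x) \<longlonglongrightarrow> A x" for x
  proof -
    have "(\<lambda>n. A x + inverse (real (Suc n)) *\<^sub>R x) \<longlonglongrightarrow> A x + 0 *\<^sub>R x"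
      by (intro tendsto_intros LIMSEQ_inverse_real_of_nat)
    then show ?thesis by (simp add: An_def op_simps)
  qed
  have "decreases_to An A"
    unfolding decreases_to_def
  proof (intro conjI allI lim)
    fix n
    have "An n - An (Suc n) = (inverse (real (Suc n)) - inverse (real (Suc (Suc n)))) *\<^sub>R id_blinfun"
      by (simp add: An_def scaleR_diff_left)
    moreover have "inverse (real (Suc (Suc n))) \<le> inverse (real (Suc n))" by (rule le_imp_inverse_le) auto
    ultimately show "An (Suc n) \<preceq> An n" by (simp add: op_le_def pos_ops_scaleR pos_ops_id)
  qed
  moreover have "decreases_to (\<lambda>_. X) X" by (simp add: decreases_to_def op_le_refl)
  ultimately have "decreases_to (\<lambda>n. \<sigma> (An n) X) (\<sigma> A X)"
    using An_pos A X by (intro conn_continuous) auto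
  then have "(\<lambda>n. (c *\<^sub>R An n) x) \<longlonglongrightarrow> \<sigma> A X x" for x
    by (simp add: decreases_to_def strict [OF An X])
  moreover have "(\<lambda>n. (c *\<^sub>R An n) x) \<longlonglongrightarrow> (c *\<^sub>R A) x" for x
    unfolding op_simps by (intro tendsto_intros lim)
  ultimately show "\<sigma> A X = c *\<^sub>R A" by (intro blinfun_eqI) (rule LIMSEQ_unique)
qed

end

text \<open>On the image of a compact set an injective continuous function has a continuous inverse.
  Monotonicity supplies such a set: K lies in the image of [0, m], where f m is the largest element
  of K.\<close>

lemma continuous_on_inverse_monotone:
  fixes f :: "real \<Rightarrow> real"
  assumes f: "continuous_on {0..} f" and mono: "\<And>s t. 0 \<le> s \<Longrightarrow> s \<le> t \<Longrightarrow> f s \<le> f t"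
    and inj: "inj_on f {0..}" and K: "compact K" "K \<subseteq> f ` {0..}"
  shows "continuous_on K (the_inv_into {0..} f)"
proof (cases "K = {}")
  case False
  then obtain k where k: "k \<in> K" "\<And>y. y \<in> K \<Longrightarrow> y \<le> k"
    using compact_attains_sup [OF K(1)] by auto
  then obtain m where m: "0 \<le> m" "f m = k" using K(2) by fastforce
  have "continuous_on (f ` {0..m}) (the_inv_into {0..} f)"
    using inj by (intro continuous_on_inv continuous_on_subset [OF f])
      (auto simp: the_inv_into_f_f)
  moreover have "K \<subseteq> f ` {0..m}"
  proof
    fix y assume y: "y \<in> K"
    then obtain t where t: "0 \<le> t" "y = f t" using K(2) by auto
    have "t \<le> m"
    proof (rule ccontr)
      assume "\<not> t \<le> m"
      with mono [of m t] k(2) [OF y] t m have "f t = f m" by auto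
      with inj t m \<open>\<not> t \<le> m\<close> show False by (auto dest: inj_onD)
    qed
    with t show "y \<in> f ` {0..m}" by auto
  qed
  ultimately show ?thesis by (rule continuous_on_subset)
qed simp

text \<open>The closed formula is derived from an arbitrary solution, which gives uniqueness, and it
  yields a solution once the spectrum lies in the range. \<open>the_inv_into {0..} f\<close> is
  evaluated on that spectrum only, hence never outside the range.\<close>

theorem theorem3p1:
  fixes \<sigma> :: "'h::complex_hilbert_space op \<Rightarrow> 'h op \<Rightarrow> 'h op"
    and f :: "real \<Rightarrow> real"
    and A B :: "'h op"
  assumes "connection \<sigma>"
    and "\<not> scalar_multiple_of_left_trivial \<sigma>"
    and "representing_function \<sigma> f"
    and "A \<in> strictly_pos_ops"
    and "B \<in> pos_ops"
  shows "((\<exists>X\<in>pos_ops. \<sigma> A X = B) \<longleftrightarrow>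
           spectrum (op_powr A (- 1/2) o\<^sub>L B o\<^sub>L op_powr A (- 1/2))
             \<subseteq> complex_of_real ` f ` {0..}) \<and>
         (\<forall>X\<in>pos_ops. \<sigma> A X = B \<longrightarrow>
           X = op_powr A (1/2)
                 o\<^sub>L cfc (the_inv_into {0..} f) (op_powr A (- 1/2) o\<^sub>L B o\<^sub>L op_powr A (- 1/2))
                 o\<^sub>L op_powr A (1/2))"
proof -
  interpret represented_connection \<sigma> f
    using assms(1,3) by unfold_locales
  have inj: "inj_on f {0..}"
    using operator_monotone_inj_or_const [OF operator_monotone_f] assms(2)
      scalar_multiple_of_left_trivial_if_const [of "f 0"] by blast
  have mono: "f s \<le> f t" if "0 \<le> s" "s \<le> t" for s t
    by (rule operator_monotone_mono [OF operator_monotone_f that])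
  define R V where "R = op_powr A (1/2)" and "V = op_powr A (- 1/2)"
  note RV = strictly_pos_powr [OF assms(4), folded R_def V_def]
  note sR = pos_ops_self_adjoint [OF RV(1)] and sV = pos_ops_self_adjoint [OF RV(2)]
  have rv: "R (V x) = x" "V (R x) = x" for x
    using RV(4,5) by (metis blinfun_apply_blinfun_compose blinfun_apply_id_blinfun)+
  have VRXRV: "V o\<^sub>L (R o\<^sub>L X o\<^sub>L R) o\<^sub>L V = X" "R o\<^sub>L (V o\<^sub>L X o\<^sub>L V) o\<^sub>L R = X" for X
    by (rule blinfun_eqI, simp add: rv)+
  note conn = conn_eq_sandwich [OF assms(4), folded R_def V_def]
  define g C where "g = the_inv_into {0..} f" and "C = V o\<^sub>L B o\<^sub>L V"
  have gf: "g (f t) = t" if "0 \<le> t" for t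
    using that by (simp add: g_def the_inv_into_f_f [OF inj])
  have C: "C \<in> pos_ops" unfolding C_def by (rule pos_ops_sandwich [OF sV assms(5)])
  note sC = pos_ops_self_adjoint [OF C]
  have g_cont: "continuous_on K g" if "compact K" "K \<subseteq> f ` {0..}" for K
    unfolding g_def by (rule continuous_on_inverse_monotone [OF continuous_on_f mono inj that]) auto
  have solution: "real_spectrum C \<subseteq> f ` {0..} \<and> X = R o\<^sub>L cfc g C o\<^sub>L R"
    if X: "X \<in> pos_ops" and eq: "\<sigma> A X = B" for X
  proof -
    define Y where "Y = V o\<^sub>L X o\<^sub>L V"
    have Y: "Y \<in> pos_ops" unfolding Y_def by (rule pos_ops_sandwich [OF sV X])
    note sY = pos_ops_self_adjoint [OF Y]
    have nonneg: "real_spectrum Y \<subseteq> {0..}" using real_spectrum_pos [OF Y] by auto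
    have f: "continuous_on (real_spectrum Y) f" by (rule continuous_on_f [OF nonneg])
    \<comment> \<open>Multiplying by V on both sides undoes the sandwich in B = R f(Y) R.\<close>
    have CY: "C = cfc f Y"
      unfolding C_def eq [symmetric] conn [OF X] VRXRV Y_def ..
    have "cfc g C = cfc (\<lambda>r. g (f r)) Y"
      unfolding CY using nonneg
      by (intro cfc_compose sY f g_cont compact_continuous_image compact_real_spectrum) auto
    also have "\<dots> = cfc (\<lambda>r. r) Y" using nonneg gf by (intro cfc_cong) auto
    finally have "cfc g C = Y" by (simp add: cfc_ident [OF sY])
    then have "X = R o\<^sub>L cfc g C o\<^sub>L R" by (simp only: Y_def VRXRV)
    moreover have "real_spectrum C \<subseteq> f ` {0..}"
      using real_spectrum_cfc [OF sY f] nonneg unfolding CY by blast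
    ultimately show ?thesis by blast
  qed
  have exists: "\<exists>X\<in>pos_ops. \<sigma> A X = B" if sp: "real_spectrum C \<subseteq> f ` {0..}"
  proof -
    have g: "continuous_on (real_spectrum C) g" by (rule g_cont [OF compact_real_spectrum [OF sC] sp])
    have g0: "0 \<le> g r \<and> f (g r) = r" if "r \<in> real_spectrum C" for r
      using sp that by (auto simp: gf)
    have Y: "cfc g C \<in> pos_ops" using g0 by (intro cfc_nonneg sC g) auto
    have X: "R o\<^sub>L cfc g C o\<^sub>L R \<in> pos_ops" by (rule pos_ops_sandwich [OF sR Y])
    have "cfc f (cfc g C) = cfc (\<lambda>r. f (g r)) C"
      using g0 by (intro cfc_compose sC g continuous_on_f) auto
    also have "\<dots> = cfc (\<lambda>r. r) C" using g0 by (intro cfc_cong) auto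
    finally have "\<sigma> A (R o\<^sub>L cfc g C o\<^sub>L R) = R o\<^sub>L C o\<^sub>L R"
      unfolding conn [OF X] VRXRV by (simp add: cfc_ident [OF sC])
    also have "\<dots> = B" unfolding C_def by (rule VRXRV)
    finally show ?thesis using X by blast
  qed
  have "spectrum C \<subseteq> complex_of_real ` f ` {0..} \<longleftrightarrow> real_spectrum C \<subseteq> f ` {0..}"
    unfolding spectrum_self_adjoint [OF sC] by (simp add: inj_image_subset_iff inj_of_real)
  with solution exists show ?thesis
    unfolding R_def [symmetric] V_def [symmetric] g_def [symmetric] C_def [symmetric] by blast
qed

end
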